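(* Let $1<p<\infty$ and let $(\Omega,\Sigma,\mu)$ be a $\sigma$-finite measure space such that $L_p(\mu)$ is infinite-dimensional and admits an equivalent $p$-AUS norm. Then there exists a constant $c_{p,\mu}>0$ such that $$\Theta_{L_p(\mu)}(n)\ge c_{p,\mu}\,n^{-1/p}\qquad\text{for all } n\ge1,$$ where $\Theta_{L_p(\mu)}(n)$ is the covering index of $L_p(\mu)$ at level $n$. In particular, $\Theta_{L_p(\mu)}(n)\asymp n^{-1/p}$, i.e. there are constants $c,C>0$ such that $c\,n^{-1/p}\le\Theta_{L_p(\mu)}(n)\le C\,n^{-1/p}$ for all $n\ge1$.
   Context: $L_p(\mu)$ is the usual scalar-valued Lebesgue space over $\mathbb{K}=\mathbb{R}$ or $\mathbb{C}$, with its usual norm (with respect to which $\Theta_{L_p(\mu)}$ is computed). For a Banach space $X$, $B_X$ and $S_X$ denote the closed unit ball and unit sphere. Essential inradius: for a set $A\subset X$, $$\varrho(A)=\sup\{r>0:\ \exists x\in A\ \exists Y\le X \text{ a closed subspace with } \dim X/Y<\infty,\ \dim Y=\infty,\ x+r(B_X\cap Y)\subset A\},$$ with the convention $\sup\varnothing=0$. Covering index: let $\mathcal{C}(X)$ be the family of closed, convex, bounded subsets of $X$. For $n\ge 1$, $$\Theta_X(n)=\inf\Bigl\{\max_{1\le k\le n}\varrho(A_k):\ A_1,\dots,A_n\in\mathcal{C}(X),\ B_X=\bigcup_{k=1}^n A_k\Bigr\}.$$ Asymptotic modulus of smoothness: for $t\ge0$, $$\overline{\rho}_X(t)=\sup_{x\in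 S_X}\ \inf_{Y\le X,\ \dim(X/Y)<\infty}\ \sup_{y\in S_Y}(\|x+ty\|-1),$$ the infimum being over closed finite-codimensional subspaces $Y$. For $p\in(1,\infty)$, the norm of $X$ is $p$-AUS if there is $C>0$ with $\overline{\rho}_X(t)\le C t^p$ for all $t>0$. *)

theory Defs
  imports "HOL-Analysis.Analysis"
begin

text \<open>
  \<open>L\<^sub>p(\<mu>)\<close> depends on the measure \<open>\<mu>\<close>, hence cannot be a type. Vector spaces and normed spaces are
  therefore structures with an explicit carrier, over a scalar field \<open>'k\<close>, to be instantiated
  with \<^typ>\<open>real\<close> or \<^typ>\<open>complex\<close>. Subspaces are always \<open>'k\<close>-linear, dimensions are over \<open>'k\<close>.
\<close>

record ('k, 'v) vspace =
  vecs :: "'v set"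
  vzero :: "'v"
  vadd :: "'v \<Rightarrow> 'v \<Rightarrow> 'v"
  vscale :: "'k \<Rightarrow> 'v \<Rightarrow> 'v"

record ('k, 'v) nspace = "('k, 'v) vspace" +
  vnorm :: "'v \<Rightarrow> real"

definition vsubspace :: "('k, 'v, 'z) vspace_scheme \<Rightarrow> 'v set \<Rightarrow> bool" where
  "vsubspace V W \<longleftrightarrow> W \<subseteq> vecs V \<and> vzero V \<in> W \<and>
     (\<forall>x\<in>W. \<forall>y\<in>W. vadd V x y \<in> W) \<and> (\<forall>c. \<forall>x\<in>W. vscale V c x \<in> W)"

definition vspan :: "('k, 'v, 'z) vspace_scheme \<Rightarrow> 'v set \<Rightarrow> 'v set" where
  "vspan V B = \<Inter> {W. vsubspace V W \<and> B \<subseteq> W}"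

definition finite_dim :: "('k, 'v, 'z) vspace_scheme \<Rightarrow> bool" where
  "finite_dim V \<longleftrightarrow> (\<exists>B. finite B \<and> B \<subseteq> vecs V \<and> vspan V B = vecs V)"

text \<open>
  The quotient by a subspace \<open>W\<close>, with cosets as elements. The summand \<open>w\<close> in the scalar
  multiplication is only needed for the scalar \<open>0\<close>.
\<close>

definition quotient_space :: "('k, 'v, 'z) vspace_scheme \<Rightarrow> 'v set \<Rightarrow> ('k, 'v set) vspace" where
  "quotient_space V W =
     \<lparr> vecs = (\<lambda>x. {vadd V x w | w. w \<in> W}) ` vecs V,
       vzero = W,
       vadd = (\<lambda>F G. {vadd V f g | f g. f \<in> F \<and> g \<in> G}),
       vscale = (\<lambda>c F. {vadd V (vscale V c f) w | f w. f \<in> F \<and> w \<in> W}) \<rparr>"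


subsection \<open>The spaces \<open>L\<^sub>p(\<mu>)\<close>\<close>

definition Lp_functions :: "'a measure \<Rightarrow> real \<Rightarrow> ('k::real_normed_field, 'a \<Rightarrow> 'k) vspace" where
  "Lp_functions M p =
     \<lparr> vecs = {f \<in> borel_measurable M. integrable M (\<lambda>x. norm (f x) powr p)},
       vzero = (\<lambda>x. 0),
       vadd = (\<lambda>f g x. f x + g x),
       vscale = (\<lambda>c f x. c * f x) \<rparr>"

definition null_functions :: "'a measure \<Rightarrow> ('a \<Rightarrow> 'k::real_normed_field) set" where
  "null_functions M = {f \<in> borel_measurable M. AE x in M. f x = 0}"

text \<open>The integral below is the same for all members \<open>f\<close> of the class \<open>F\<close>.\<close>

definition Lp_norm :: "'a measure \<Rightarrow> real \<Rightarrow> ('a \<Rightarrow> 'k::real_normed_field) set \<Rightarrow> real" where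
  "Lp_norm M p F = (let f = (SOME f. f \<in> F) in (\<integral>x. norm (f x) powr p \<partial>M) powr (1 / p))"

definition Lp_space :: "'a measure \<Rightarrow> real \<Rightarrow> ('k::real_normed_field, ('a \<Rightarrow> 'k) set) nspace" where
  "Lp_space M p =
     vspace.extend (quotient_space (Lp_functions M p) (null_functions M)) (nspace.fields (Lp_norm M p))"


subsection \<open>Normed spaces\<close>

definition unit_ball :: "('k, 'v, 'z) nspace_scheme \<Rightarrow> 'v set" where
  "unit_ball X = {x \<in> vecs X. vnorm X x \<le> 1}"

definition unit_sphere :: "('k, 'v, 'z) nspace_scheme \<Rightarrow> 'v set" where
  "unit_sphere X = {x \<in> vecs X. vnorm X x = 1}"

text \<open>
  The locale \<open>Metric_space\<close> requires symmetry and nonnegativity also off the carrier, hence the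
  value \<open>0\<close> there.
\<close>

definition ndist :: "('k::real_normed_field, 'v, 'z) nspace_scheme \<Rightarrow> 'v \<Rightarrow> 'v \<Rightarrow> real" where
  "ndist X x y =
     (if x \<in> vecs X \<and> y \<in> vecs X then vnorm X (vadd X x (vscale X (- 1) y)) else 0)"

definition norm_closed :: "('k::real_normed_field, 'v, 'z) nspace_scheme \<Rightarrow> 'v set \<Rightarrow> bool" where
  "norm_closed X A \<longleftrightarrow> closedin (Metric_space.mtopology (vecs X) (ndist X)) A"

definition vconvex :: "('k::real_normed_field, 'v, 'z) vspace_scheme \<Rightarrow> 'v set \<Rightarrow> bool" where
  "vconvex V A \<longleftrightarrow> (\<forall>x\<in>A. \<forall>y\<in>A. \<forall>t::real. 0 \<le> t \<and> t \<le> 1 \<longrightarrow>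
     vadd V (vscale V (of_real (1 - t)) x) (vscale V (of_real t) y) \<in> A)"

definition norm_bounded :: "('k, 'v, 'z) nspace_scheme \<Rightarrow> 'v set \<Rightarrow> bool" where
  "norm_bounded X A \<longleftrightarrow> (\<exists>b. \<forall>x\<in>A. vnorm X x \<le> b)"

definition closed_fincodim_subspace ::
    "('k::real_normed_field, 'v, 'z) nspace_scheme \<Rightarrow> 'v set \<Rightarrow> bool" where
  "closed_fincodim_subspace X Y \<longleftrightarrow>
     vsubspace X Y \<and> norm_closed X Y \<and> finite_dim (quotient_space X Y)"


subsection \<open>Essential inradius and covering index\<close>

text \<open>In \<^typ>\<open>ennreal\<close> the supremum of the empty set is \<open>0\<close>.\<close>

definition essential_inradius ::
    "('k::real_normed_field, 'v, 'z) nspace_scheme \<Rightarrow> 'v set \<Rightarrow> ennreal" where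
  "essential_inradius X A = Sup {ennreal r | r. 0 < r \<and>
     (\<exists>x\<in>A. \<exists>Y. closed_fincodim_subspace X Y \<and> \<not> finite_dim (X\<lparr>vecs := Y\<rparr>) \<and>
        (\<lambda>y. vadd X x (vscale X (of_real r) y)) ` (unit_ball X \<inter> Y) \<subseteq> A)}"

definition closed_convex_bounded ::
    "('k::real_normed_field, 'v, 'z) nspace_scheme \<Rightarrow> 'v set set" where
  "closed_convex_bounded X =
     {A. A \<subseteq> vecs X \<and> norm_closed X A \<and> vconvex X A \<and> norm_bounded X A}"

definition covering_index ::
    "('k::real_normed_field, 'v, 'z) nspace_scheme \<Rightarrow> nat \<Rightarrow> ennreal" where
  "covering_index X n = Inf {Max ((\<lambda>k. essential_inradius X (A k)) ` {1..n}) | A.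
     (\<forall>k\<in>{1..n}. A k \<in> closed_convex_bounded X) \<and> unit_ball X = (\<Union>k\<in>{1..n}. A k)}"


subsection \<open>Asymptotic uniform smoothness\<close>

definition asymptotic_smoothness ::
    "('k::real_normed_field, 'v, 'z) nspace_scheme \<Rightarrow> real \<Rightarrow> ereal" where
  "asymptotic_smoothness X t =
     (SUP x\<in>unit_sphere X. INF Y\<in>{Y. closed_fincodim_subspace X Y}. SUP y\<in>unit_sphere X \<inter> Y.
        ereal (vnorm X (vadd X x (vscale X (of_real t) y)) - 1))"

definition AUS_norm :: "real \<Rightarrow> ('k::real_normed_field, 'v, 'z) nspace_scheme \<Rightarrow> bool" where
  "AUS_norm p X \<longleftrightarrow> (\<exists>C>0. \<forall>t>0. asymptotic_smoothness X t \<le> ereal (C * t powr p))"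

definition is_norm :: "('k::real_normed_field, 'v, 'z) vspace_scheme \<Rightarrow> ('v \<Rightarrow> real) \<Rightarrow> bool" where
  "is_norm V N \<longleftrightarrow>
     (\<forall>x\<in>vecs V. 0 \<le> N x \<and> (N x = 0 \<longleftrightarrow> x = vzero V)) \<and>
     (\<forall>c. \<forall>x\<in>vecs V. N (vscale V c x) = norm c * N x) \<and>
     (\<forall>x\<in>vecs V. \<forall>y\<in>vecs V. N (vadd V x y) \<le> N x + N y)"

definition equivalent_norm ::
    "('k::real_normed_field, 'v, 'z) nspace_scheme \<Rightarrow> ('v \<Rightarrow> real) \<Rightarrow> bool" where
  "equivalent_norm X N \<longleftrightarrow> is_norm X N \<and>
     (\<exists>a>0. \<exists>b>0. \<forall>x\<in>vecs X. a * vnorm X x \<le> N x \<and> N x \<le> b * vnorm X x)"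

definition AUS_renormable :: "real \<Rightarrow> ('k::real_normed_field, 'v, 'z) nspace_scheme \<Rightarrow> bool" where
  "AUS_renormable p X \<longleftrightarrow> (\<exists>N. equivalent_norm X N \<and> AUS_norm p (X\<lparr>vnorm := N\<rparr>))"

end

theory Submission
  imports Defs
begin

text \<open>
  Lower bound. Let \<open>N\<close> be an equivalent \<open>p\<close>-AUS norm, let \<open>A\<^sub>1, \<dots>, A\<^sub>n\<close> cover the unit ball and suppose
  that all essential inradii are smaller than \<open>r = c n\<^bsup>-1/p\<^esup>\<close>. Start at \<open>0\<close>. Whenever the current point \<open>x\<close>
  lies in \<open>A\<^sub>k\<close>, every closed finite-codimensional subspace contains some \<open>y\<close> of norm at most \<open>r\<close> with
  \<open>x + y\<close> outside \<open>A\<^sub>k\<close>. By Hahn-Banach a closed finite-codimensional \<open>H\<close> satisfies \<open>x + y + H\<close> disjoint from \<open>A\<^sub>k\<close>,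
  so if all later increments are taken in \<open>H\<close>, the set \<open>A\<^sub>k\<close> is never met again. Smoothness lets the increments
  be chosen such that \<open>N\<^bsup>p\<^esup>\<close> grows by at most a constant times \<open>r\<^bsup>p\<^esup>\<close> per step; hence after \<open>n\<close> steps the
  point is still in the unit ball but in none of the sets.

  Upper bound. Choose disjoint sets \<open>D\<^sub>1, \<dots>, D\<^sub>n\<close> with every \<open>L\<^sub>p(D\<^sub>i)\<close> infinite-dimensional. A function in the
  unit ball has norm at most \<open>n\<^bsup>-1/p\<^esup>\<close> on one of the \<open>D\<^sub>i\<close>, and the slab of all functions in the ball with this
  property has essential inradius at most \<open>n\<^bsup>-1/p\<^esup>\<close>, as every finite-codimensional subspace meets \<open>L\<^sub>p(D\<^sub>i)\<close>.
\<close>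

subsection \<open>Vector spaces on a carrier\<close>

text \<open>Negatives are not a separate operation: multiplication by \<open>- 1\<close> provides
  them, and the inverse law follows from \<open>zero_scale\<close> and
  \<open>add_scale\<close>.\<close>

locale vector_structure =
  fixes V :: "('k::real_normed_field, 'v, 'z) vspace_scheme"
  assumes zero_closed [simp]: "vzero V \<in> vecs V"
    and add_closed [simp]: "\<lbrakk>x \<in> vecs V; y \<in> vecs V\<rbrakk> \<Longrightarrow> vadd V x y \<in> vecs V"
    and scale_closed [simp]: "x \<in> vecs V \<Longrightarrow> vscale V c x \<in> vecs V"
    and add_assoc: "\<lbrakk>x \<in> vecs V; y \<in> vecs V; z \<in> vecs V\<rbrakk>
      \<Longrightarrow> vadd V (vadd V x y) z = vadd V x (vadd V y z)"
    and add_commute: "\<lbrakk>x \<in> vecs V; y \<in> vecs V\<rbrakk> \<Longrightarrow> vadd V x y = vadd V y x"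
    and add_zero [simp]: "x \<in> vecs V \<Longrightarrow> vadd V x (vzero V) = x"
    and zero_scale [simp]: "x \<in> vecs V \<Longrightarrow> vscale V 0 x = vzero V"
    and one_scale [simp]: "x \<in> vecs V \<Longrightarrow> vscale V 1 x = x"
    and scale_scale [simp]: "x \<in> vecs V \<Longrightarrow> vscale V a (vscale V b x) = vscale V (a * b) x"
    and scale_add: "\<lbrakk>x \<in> vecs V; y \<in> vecs V\<rbrakk>
      \<Longrightarrow> vscale V a (vadd V x y) = vadd V (vscale V a x) (vscale V a y)"
    and add_scale: "x \<in> vecs V \<Longrightarrow> vscale V (a + b) x = vadd V (vscale V a x) (vscale V b x)"
begin

abbreviation add (infixl "\<oplus>" 65) where "x \<oplus> y \<equiv> vadd V x y"
abbreviation scale (infixr "\<odot>" 75) where "c \<odot> x \<equiv> vscale V c x"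
abbreviation sub (infixl "\<ominus>" 65) where "x \<ominus> y \<equiv> vadd V x (vscale V (- 1) y)"

lemma add_left_commute:
  "\<lbrakk>x \<in> vecs V; y \<in> vecs V; z \<in> vecs V\<rbrakk> \<Longrightarrow> x \<oplus> (y \<oplus> z) = y \<oplus> (x \<oplus> z)"
  by (metis add_assoc add_commute)

lemmas add_ac = add_assoc add_commute add_left_commute

lemma zero_add [simp]: "x \<in> vecs V \<Longrightarrow> vzero V \<oplus> x = x"
  by (metis add_commute add_zero zero_closed)

lemma scale_zero [simp]: "c \<odot> vzero V = vzero V"
  by (metis mult_zero_right scale_scale zero_closed zero_scale)

lemma scale_cancel [simp]:
  assumes "x \<in> vecs V"
  shows "c \<odot> x \<oplus> (- c) \<odot> x = vzero V" "(- c) \<odot> x \<oplus> c \<odot> x = vzero V"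
  using assms add_scale[of x c "- c"] add_scale[of x "- c" c] by auto

lemma scale_cancel_left [simp]:
  assumes "x \<in> vecs V" "y \<in> vecs V"
  shows "c \<odot> x \<oplus> ((- c) \<odot> x \<oplus> y) = y" "(- c) \<odot> x \<oplus> (c \<odot> x \<oplus> y) = y"
  using assms by (simp_all flip: add_assoc)

lemma sub_self [simp]: "x \<in> vecs V \<Longrightarrow> x \<ominus> x = vzero V"
  using scale_cancel(1)[of x 1] by simp

lemma neg_add_self [simp]: "x \<in> vecs V \<Longrightarrow> (- 1) \<odot> x \<oplus> x = vzero V"
  using scale_cancel(2)[of x 1] by simp

lemma add_neg_cancel [simp]:
  assumes "x \<in> vecs V" "y \<in> vecs V"
  shows "x \<oplus> ((- 1) \<odot> x \<oplus> y) = y" "(- 1) \<odot> x \<oplus> (x \<oplus> y) = y"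
  using assms scale_cancel_left[of x y 1] by simp_all

text \<open>Ordered rewriting with \<open>add_ac\<close> need not place a vector next to its
  negative. These rules cancel the pair across one or two intermediate summands.\<close>

lemma add_neg_cancel_gap [simp]:
  assumes "x \<in> vecs V" "y \<in> vecs V" "z \<in> vecs V" "w \<in> vecs V"
  shows "x \<oplus> (y \<ominus> x) = y" "x \<oplus> (y \<oplus> ((- 1) \<odot> x \<oplus> z)) = y \<oplus> z"
    "x \<oplus> (y \<oplus> (z \<ominus> x)) = y \<oplus> z" "x \<oplus> (y \<oplus> (z \<oplus> ((- 1) \<odot> x \<oplus> w))) = y \<oplus> (z \<oplus> w)"
proof -
  show "x \<oplus> (y \<ominus> x) = y" "x \<oplus> (y \<oplus> ((- 1) \<odot> x \<oplus> z)) = y \<oplus> z"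
    "x \<oplus> (y \<oplus> (z \<ominus> x)) = y \<oplus> z" "x \<oplus> (y \<oplus> (z \<oplus> ((- 1) \<odot> x \<oplus> w))) = y \<oplus> (z \<oplus> w)"
    using assms add_left_commute[of x y] add_left_commute[of x z] by simp_all
qed

lemma sub_add_cancel [simp]:
  assumes "x \<in> vecs V" "y \<in> vecs V"
  shows "x \<ominus> y \<oplus> y = x" "x \<oplus> y \<ominus> y = x"
  using assms by (simp_all add: add_assoc)

lemma add_cancel:
  assumes "x \<in> vecs V" "y \<in> vecs V" "z \<in> vecs V" "x \<oplus> y = x \<oplus> z"
  shows "y = z"
  by (metis add_neg_cancel(2) assms)

lemma sub_eq_zero:
  assumes "x \<in> vecs V" "y \<in> vecs V" "x \<ominus> y = vzero V"
  shows "x = y"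
  by (metis assms sub_add_cancel(1) zero_add)

section \<open>Subspaces, spans and finite generation\<close>

lemma subspaceD:
  assumes "vsubspace V W"
  shows "W \<subseteq> vecs V" "vzero V \<in> W" "\<lbrakk>x \<in> W; y \<in> W\<rbrakk> \<Longrightarrow> x \<oplus> y \<in> W" "x \<in> W \<Longrightarrow> c \<odot> x \<in> W"
    "x \<in> W \<Longrightarrow> x \<in> vecs V"
  using assms by (auto simp: vsubspace_def)

lemma subspace_carrier [simp]: "vsubspace V (vecs V)"
  by (simp add: vsubspace_def)

lemma subspace_Int: "vsubspace V U \<Longrightarrow> vsubspace V W \<Longrightarrow> vsubspace V (U \<inter> W)"
  by (auto simp: vsubspace_def)

lemma span_least: "vsubspace V W \<Longrightarrow> B \<subseteq> W \<Longrightarrow> vspan V B \<subseteq> W"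
  by (auto simp: vspan_def)

lemma span_superset: "B \<subseteq> vspan V B"
  by (auto simp: vspan_def)

lemma span_mono: "A \<subseteq> B \<Longrightarrow> vspan V A \<subseteq> vspan V B"
  by (auto simp: vspan_def)

lemma subspace_span: "B \<subseteq> vecs V \<Longrightarrow> vsubspace V (vspan V B)"
  using subspace_carrier unfolding vspan_def vsubspace_def by blast

text \<open>The generators may lie outside \<open>W\<close>. The notion therefore passes to subsets
  at once, without choosing a basis of the subset.\<close>

definition finitely_spanned :: "'v set \<Rightarrow> bool" where
  "finitely_spanned W \<longleftrightarrow> (\<exists>B. finite B \<and> B \<subseteq> vecs V \<and> W \<subseteq> vspan V B)"

lemma finite_dim_if_finitely_spanned: "finitely_spanned (vecs V) \<Longrightarrow> finite_dim V"
  unfolding finitely_spanned_def finite_dim_def by (metis antisym span_least subspace_carrier)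

text \<open>The span formed inside \<open>W\<close> is an intersection over the subspaces of
  \<open>W\<close>, and \<open>vspan V B \<inter> W\<close> is one of them.\<close>

lemma finitely_spanned_if_finite_dim:
  assumes "finite_dim (V\<lparr>vecs := W\<rparr>)" "vsubspace V W"
  shows "finitely_spanned W"
proof -
  obtain B where B: "finite B" "B \<subseteq> W" "vspan (V\<lparr>vecs := W\<rparr>) B = W"
    using assms(1) by (auto simp: finite_dim_def)
  have BV: "B \<subseteq> vecs V" using B assms(2) by (auto simp: vsubspace_def)
  have "vsubspace (V\<lparr>vecs := W\<rparr>) (vspan V B \<inter> W)"
    using subspace_Int[OF subspace_span[OF BV] assms(2)] by (auto simp: vsubspace_def)
  then have "vspan (V\<lparr>vecs := W\<rparr>) B \<subseteq> vspan V B \<inter> W"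
    using B(2) span_superset by (auto simp: vspan_def)
  then show ?thesis using B BV by (auto simp: finitely_spanned_def)
qed

subsection \<open>Finite codimension\<close>

text \<open>Codimension at most one: Z is Y plus the line through b, where b may lie in Y. Finite
  codimension becomes the reflexive transitive closure, so that proofs go by induction along a chain
  and no dimension is counted.\<close>

definition codim1 :: "'v set \<Rightarrow> 'v set \<Rightarrow> bool" where
  "codim1 Z Y \<longleftrightarrow> vsubspace V Z \<and> vsubspace V Y \<and> Y \<subseteq> Z \<and>
     (\<exists>b\<in>Z. \<forall>z\<in>Z. \<exists>c. z \<ominus> c \<odot> b \<in> Y)"

abbreviation fincodim :: "'v set \<Rightarrow> 'v set \<Rightarrow> bool" where
  "fincodim \<equiv> codim1\<^sup>*\<^sup>*"

text \<open>If \<open>Z \<inter> W\<close> is not contained in Y, then any of its vectors b' outside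
  Y spans Z modulo Y, the codimension being at most one. It replaces b, which need not lie in
  W.\<close>

lemma codim1_Int:
  assumes ZY: "codim1 Z Y" and W: "vsubspace V W"
  shows "codim1 (Z \<inter> W) (Y \<inter> W)"
proof -
  obtain b where Z: "vsubspace V Z" "vsubspace V Y" "Y \<subseteq> Z" "b \<in> Z"
    and b: "\<And>z. z \<in> Z \<Longrightarrow> \<exists>c. z \<ominus> c \<odot> b \<in> Y"
    using ZY by (auto simp: codim1_def)
  have "\<exists>b'\<in>Z \<inter> W. \<forall>z\<in>Z \<inter> W. \<exists>c. z \<ominus> c \<odot> b' \<in> Y \<inter> W"
  proof (cases "Z \<inter> W \<subseteq> Y")
    case True
    then show ?thesis
      using subspaceD[OF Z(1)] subspaceD[OF W] by (intro bexI[of _ "vzero V"]) auto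
  next
    case False
    then obtain b' where b': "b' \<in> Z" "b' \<in> W" "b' \<notin> Y" by auto
    obtain c where c: "b' \<ominus> c \<odot> b \<in> Y" using b b' by blast
    note mem = subspaceD(5)[OF Z(1)] subspaceD(5)[OF Z(2)] subspaceD(5)[OF W]
    have [simp]: "b \<in> vecs V" "b' \<in> vecs V" using mem b' Z by auto
    have "c \<noteq> 0" using c b' by auto
    have "\<exists>c. z \<ominus> c \<odot> b' \<in> Y \<inter> W" if z: "z \<in> Z" "z \<in> W" for z
    proof -
      obtain d where d: "z \<ominus> d \<odot> b \<in> Y" using b z by blast
      have [simp]: "z \<in> vecs V" using mem z by auto
      \<comment> \<open>Eliminates b: (z - d b) - (d/c) (b' - c b) = z - (d/c) b'.\<close>
      have "(z \<ominus> d \<odot> b) \<oplus> (- d / c) \<odot> (b' \<ominus> c \<odot> b) \<in> Y"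
        using d c subspaceD(3,4)[OF Z(2)] by meson
      also have "(z \<ominus> d \<odot> b) \<oplus> (- d / c) \<odot> (b' \<ominus> c \<odot> b) = z \<ominus> (d / c) \<odot> b'"
        using \<open>c \<noteq> 0\<close> by (simp add: add_ac scale_add)
      finally have "z \<ominus> (d / c) \<odot> b' \<in> Y" .
      moreover have "z \<ominus> (d / c) \<odot> b' \<in> W"
        using z b' by (intro subspaceD[OF W]) auto
      ultimately show ?thesis by blast
    qed
    then show ?thesis using b' by blast
  qed
  then show ?thesis
    using Z W by (auto simp: codim1_def intro: subspace_Int)
qed

lemma fincodim_Int:
  assumes "fincodim Z Y" and W: "vsubspace V W"
  shows "fincodim (Z \<inter> W) (Y \<inter> W)"
  using assms(1)
proof induction
  case (step Y Y')
  then show ?case using codim1_Int[OF _ W] by (meson rtranclp.rtrancl_into_rtrancl)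
qed simp

lemma fincodim_subset: "fincodim Z Y \<Longrightarrow> Y \<subseteq> Z"
  by (induction rule: rtranclp_induct) (auto simp: codim1_def)

text \<open>The chain from the whole space down to Y1 is continued by the chain for Y2 intersected
  with Y1.\<close>

lemma fincodim_Int_carrier:
  assumes "fincodim (vecs V) Y1" "fincodim (vecs V) Y2" "vsubspace V Y1"
  shows "fincodim (vecs V) (Y1 \<inter> Y2)"
proof -
  have "fincodim (vecs V \<inter> Y1) (Y2 \<inter> Y1)" using assms by (intro fincodim_Int)
  moreover have "vecs V \<inter> Y1 = Y1" using assms(3) by (auto simp: vsubspace_def)
  ultimately show ?thesis using assms(1) by (simp add: Int_commute)
qed

lemma codim1_sum:
  assumes "vsubspace V Y" "b \<in> vecs V"
  shows "codim1 {z \<in> vecs V. \<exists>c. z \<ominus> c \<odot> b \<in> Y} Y" (is "codim1 ?Z Y")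
proof -
  note [simp] = assms(2)
  have "vsubspace V ?Z"
    unfolding vsubspace_def
  proof (intro conjI ballI allI)
    show "vzero V \<in> ?Z" using subspaceD[OF assms(1)] by (auto intro: exI[of _ 0])
  next
    fix x y assume "x \<in> ?Z" "y \<in> ?Z"
    then obtain c d where cd: "x \<ominus> c \<odot> b \<in> Y" "y \<ominus> d \<odot> b \<in> Y"
      and [simp]: "x \<in> vecs V" "y \<in> vecs V" by auto
    have "(x \<ominus> c \<odot> b) \<oplus> (y \<ominus> d \<odot> b) \<in> Y" using cd subspaceD(3)[OF assms(1)] by meson
    also have "(x \<ominus> c \<odot> b) \<oplus> (y \<ominus> d \<odot> b) = x \<oplus> y \<ominus> (c + d) \<odot> b"
      using add_scale[of b "- c" "- d"] by (simp add: add_ac)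
    finally show "x \<oplus> y \<in> ?Z" by (auto intro!: exI[of _ "c + d"])
  next
    fix a x assume "x \<in> ?Z"
    then obtain c where c: "x \<ominus> c \<odot> b \<in> Y" and [simp]: "x \<in> vecs V" by auto
    have "a \<odot> (x \<ominus> c \<odot> b) \<in> Y" using c subspaceD(4)[OF assms(1)] by meson
    also have "a \<odot> (x \<ominus> c \<odot> b) = a \<odot> x \<ominus> (a * c) \<odot> b"
      by (simp add: scale_add)
    finally show "a \<odot> x \<in> ?Z" by auto
  qed auto
  moreover have "Y \<subseteq> ?Z" using subspaceD[OF assms(1)] by (auto intro: exI[of _ 0])
  moreover have "b \<in> ?Z" using subspaceD[OF assms(1)] by (auto intro: exI[of _ 1])
  ultimately show ?thesis using assms(1) unfolding codim1_def by blast
qed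

text \<open>The vectors of B are adjoined to Y one at a time, each costing at most one
  dimension.\<close>

lemma fincodim_extend:
  assumes "finite B" "B \<subseteq> vecs V" "vsubspace V Y"
  shows "\<exists>Z. fincodim Z Y \<and> vsubspace V Z \<and> B \<subseteq> Z"
  using assms
proof (induction rule: finite_induct)
  case empty
  then show ?case by blast
next
  case (insert b B)
  then obtain Z where Z: "fincodim Z Y" "vsubspace V Z" "B \<subseteq> Z" by auto
  have b: "b \<in> vecs V" using insert by auto
  let ?Z = "{z \<in> vecs V. \<exists>c. z \<ominus> c \<odot> b \<in> Z}"
  have 1: "codim1 ?Z Z" using codim1_sum[OF Z(2) b] .
  have "b \<in> ?Z" using b subspaceD[OF Z(2)] by (auto intro: exI[of _ 1])
  moreover have "fincodim ?Z Y" using 1 Z(1) by (rule converse_rtranclp_into_rtranclp)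
  moreover have "B \<subseteq> ?Z" "vsubspace V ?Z" using 1 Z(3) unfolding codim1_def by blast+
  ultimately show ?case by blast
qed

text \<open>B collects the vector b of each link of the chain. Generation of Z by Y and B is
  expressed by quantifying over all subspaces U, which is the form used for preimages of spans in
  the quotient.\<close>

lemma fincodim_spanned:
  assumes "fincodim Z Y" "Z \<subseteq> vecs V"
  shows "\<exists>B. finite B \<and> B \<subseteq> Z \<and> (\<forall>U. vsubspace V U \<and> Y \<subseteq> U \<and> B \<subseteq> U \<longrightarrow> Z \<subseteq> U)"
  using assms(1)
proof (induction rule: rtranclp_induct)
  case base
  then show ?case by (intro exI[of _ "{}"]) auto
next
  case (step Y Y')
  from step.IH obtain B where B: "finite B" "B \<subseteq> Z"
    and BU: "\<forall>U. vsubspace V U \<and> Y \<subseteq> U \<and> B \<subseteq> U \<longrightarrow> Z \<subseteq> U" by auto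
  obtain b where b: "b \<in> Y" "\<And>y. y \<in> Y \<Longrightarrow> \<exists>c. y \<ominus> c \<odot> b \<in> Y'"
    using step(2) unfolding codim1_def by blast
  have "Y \<subseteq> Z" using step(1) fincodim_subset by blast
  have "Z \<subseteq> U" if U: "vsubspace V U" "Y' \<subseteq> U" "insert b B \<subseteq> U" for U
  proof (rule BU[rule_format], intro conjI)
    show "Y \<subseteq> U"
    proof
      fix y assume "y \<in> Y"
      then obtain c where c: "y \<ominus> c \<odot> b \<in> U" using b U by blast
      have "(y \<ominus> c \<odot> b) \<oplus> c \<odot> b \<in> U" using U c subspaceD(3,4)[OF U(1)] by (meson insert_subset)
      moreover have "y \<in> vecs V" "b \<in> vecs V" using \<open>y \<in> Y\<close> b(1) \<open>Y \<subseteq> Z\<close> assms(2) by auto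
      ultimately show "y \<in> U" by (metis scale_closed sub_add_cancel(1))
    qed
  qed (use U in auto)
  then show ?case
    using B b \<open>Y \<subseteq> Z\<close> by (intro exI[of _ "insert b B"]) auto
qed

lemma finitely_spanned_fincodim:
  assumes "fincodim Z Y" "Z \<subseteq> vecs V" "finitely_spanned Y"
  shows "finitely_spanned Z"
proof -
  obtain B C where B: "finite B" "B \<subseteq> Z" "\<And>U. vsubspace V U \<Longrightarrow> Y \<subseteq> U \<Longrightarrow> B \<subseteq> U \<Longrightarrow> Z \<subseteq> U"
    and C: "finite C" "C \<subseteq> vecs V" "Y \<subseteq> vspan V C"
    using fincodim_spanned[OF assms(1,2)] assms(3) unfolding finitely_spanned_def by metis
  have "B \<subseteq> vspan V (B \<union> C)" using span_superset by blast
  moreover have "Y \<subseteq> vspan V (B \<union> C)" using C span_mono[of C "B \<union> C"] by auto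
  moreover have BC: "B \<union> C \<subseteq> vecs V" using B C assms by auto
  ultimately have "Z \<subseteq> vspan V (B \<union> C)" using B(3) subspace_span by blast
  then show ?thesis using BC B C unfolding finitely_spanned_def by blast
qed

subsection \<open>Quotients\<close>

definition coset :: "'v set \<Rightarrow> 'v \<Rightarrow> 'v set" where
  "coset W x = {x \<oplus> w | w. w \<in> W}"

lemma coset_eq:
  assumes W: "vsubspace V W" and x: "x \<in> vecs V"
  shows "coset W x = {y \<in> vecs V. y \<ominus> x \<in> W}"
proof (intro set_eqI iffI)
  fix y assume "y \<in> coset W x"
  then obtain w where w: "w \<in> W" "y = x \<oplus> w" by (auto simp: coset_def)
  then have "w \<in> vecs V" using subspaceD[OF W] by auto
  then have "y \<ominus> x = w" using w x by (simp add: add_commute)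
  then show "y \<in> {y \<in> vecs V. y \<ominus> x \<in> W}" using w x \<open>w \<in> vecs V\<close> by auto
next
  fix y assume "y \<in> {y \<in> vecs V. y \<ominus> x \<in> W}"
  then have "y = x \<oplus> (y \<ominus> x)" "y \<ominus> x \<in> W" using x by (auto simp: add_ac)
  then show "y \<in> coset W x" unfolding coset_def by blast
qed

lemma coset_eq_iff:
  assumes W: "vsubspace V W" and x: "x \<in> vecs V" "y \<in> vecs V"
  shows "coset W x = coset W y \<longleftrightarrow> x \<ominus> y \<in> W"
proof
  assume "coset W x = coset W y"
  moreover have "x \<in> coset W x" using W x by (simp add: coset_eq subspaceD)
  ultimately show "x \<ominus> y \<in> W" using W x by (simp add: coset_eq)
next
  assume xy: "x \<ominus> y \<in> W"
  show "coset W x = coset W y"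
    unfolding coset_eq[OF W x(1)] coset_eq[OF W x(2)]
  proof (intro Collect_cong conj_cong refl)
    fix z assume z: "z \<in> vecs V"
    have 1: "z \<ominus> y = (z \<ominus> x) \<oplus> (x \<ominus> y)" using x z by (simp add: add_ac)
    have 2: "z \<ominus> x = (z \<ominus> y) \<oplus> (- 1) \<odot> (x \<ominus> y)" using x z by (simp add: add_ac scale_add)
    show "(z \<ominus> x \<in> W) = (z \<ominus> y \<in> W)"
      using 1 2 xy subspaceD(3,4)[OF W] by metis
  qed
qed

context
  fixes W
  assumes W: "vsubspace V W"
begin

lemma quotient_vecs: "vecs (quotient_space V W) = coset W ` vecs V"
  by (simp add: quotient_space_def coset_def)

lemma quotient_zero: "vzero (quotient_space V W) = coset W (vzero V)"
  using subspaceD[OF W] by (force simp: quotient_space_def coset_eq[OF W])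

lemma quotient_add:
  assumes [simp]: "x \<in> vecs V" "y \<in> vecs V"
  shows "vadd (quotient_space V W) (coset W x) (coset W y) = coset W (x \<oplus> y)"
proof -
  have "{vadd V f g | f g. f \<in> coset W x \<and> g \<in> coset W y} = coset W (x \<oplus> y)"
  proof (intro set_eqI iffI)
    fix z assume "z \<in> {vadd V f g | f g. f \<in> coset W x \<and> g \<in> coset W y}"
    then obtain v w where vw: "v \<in> W" "w \<in> W" and z: "z = (x \<oplus> v) \<oplus> (y \<oplus> w)"
      by (auto simp: coset_def)
    have [simp]: "v \<in> vecs V" "w \<in> vecs V" using vw subspaceD[OF W] by auto
    have "z = (x \<oplus> y) \<oplus> (v \<oplus> w)" using z by (simp add: add_ac)
    then show "z \<in> coset W (x \<oplus> y)" using vw subspaceD[OF W] by (auto simp: coset_def)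
  next
    fix z assume "z \<in> coset W (x \<oplus> y)"
    then obtain w where w: "w \<in> W" "z = x \<oplus> y \<oplus> w" by (auto simp: coset_def)
    have [simp]: "w \<in> vecs V" using w subspaceD[OF W] by auto
    have "z = (x \<oplus> vzero V) \<oplus> (y \<oplus> w)" using w by (simp add: add_ac)
    then show "z \<in> {vadd V f g | f g. f \<in> coset W x \<and> g \<in> coset W y}"
      using w subspaceD(2)[OF W] unfolding coset_def by blast
  qed
  then show ?thesis by (simp add: quotient_space_def)
qed

lemma quotient_scale:
  assumes [simp]: "x \<in> vecs V"
  shows "vscale (quotient_space V W) c (coset W x) = coset W (c \<odot> x)"
proof -
  have "{vadd V (c \<odot> f) w | f w. f \<in> coset W x \<and> w \<in> W} = coset W (c \<odot> x)"
  proof (intro set_eqI iffI)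
    fix z assume "z \<in> {vadd V (c \<odot> f) w | f w. f \<in> coset W x \<and> w \<in> W}"
    then obtain v w where vw: "v \<in> W" "w \<in> W" and z: "z = c \<odot> (x \<oplus> v) \<oplus> w"
      by (auto simp: coset_def)
    have [simp]: "v \<in> vecs V" "w \<in> vecs V" using vw subspaceD[OF W] by auto
    have "z = c \<odot> x \<oplus> (c \<odot> v \<oplus> w)" using z by (simp add: add_ac scale_add)
    then show "z \<in> coset W (c \<odot> x)" using vw subspaceD[OF W] by (auto simp: coset_def)
  next
    fix z assume "z \<in> coset W (c \<odot> x)"
    then obtain w where w: "w \<in> W" "z = c \<odot> x \<oplus> w" by (auto simp: coset_def)
    moreover have "x \<in> coset W x" using subspaceD(2)[OF W] by (force simp: coset_def)
    ultimately show "z \<in> {vadd V (c \<odot> f) w | f w. f \<in> coset W x \<and> w \<in> W}" by blast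
  qed
  then show ?thesis by (simp add: quotient_space_def)
qed

lemma vector_structure_quotient: "vector_structure (quotient_space V W)"
proof unfold_locales
qed (auto simp: quotient_vecs quotient_zero quotient_add quotient_scale add_ac scale_add add_scale)

text \<open>Forwards, representatives of finitely many generating cosets are adjoined to W; the
  resulting Z has a quotient image containing all generators, hence Z is everything. Backwards, the
  vectors whose cosets lie in the span of the cosets of B form a subspace containing both W and
  B.\<close>

lemma finite_dim_quotient_iff: "finite_dim (quotient_space V W) \<longleftrightarrow> fincodim (vecs V) W"
proof
  interpret Q: vector_structure "quotient_space V W" by (rule vector_structure_quotient)
  assume "finite_dim (quotient_space V W)"
  then obtain B where B: "finite B" "B \<subseteq> coset W ` vecs V"
    "vspan (quotient_space V W) B = coset W ` vecs V"
    by (auto simp: finite_dim_def quotient_vecs)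
  obtain C where C: "finite C" "C \<subseteq> vecs V" "B = coset W ` C"
    using finite_subset_image[OF B(1,2)] by auto
  obtain Z where Z: "fincodim Z W" "vsubspace V Z" "C \<subseteq> Z"
    using fincodim_extend[OF C(1,2) W] by blast
  note ZV = subspaceD(5)[OF Z(2)]
  have "vsubspace (quotient_space V W) (coset W ` Z)"
    unfolding vsubspace_def
    using ZV subspaceD[OF Z(2)] by (auto simp: quotient_vecs quotient_zero quotient_add quotient_scale)
  moreover have "B \<subseteq> coset W ` Z" using C Z(3) by blast
  ultimately have "coset W ` vecs V \<subseteq> coset W ` Z" using Q.span_least B(3) by metis
  have "vecs V \<subseteq> Z"
  proof
    fix x assume x: "x \<in> vecs V"
    then obtain z where z: "z \<in> Z" "coset W x = coset W z"
      using \<open>coset W ` vecs V \<subseteq> coset W ` Z\<close> by blast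
    then have "x \<ominus> z \<in> Z" using x ZV fincodim_subset[OF Z(1)] coset_eq_iff[OF W] by blast
    then have "x \<ominus> z \<oplus> z \<in> Z" using z subspaceD[OF Z(2)] by blast
    then show "x \<in> Z" using x z ZV by simp
  qed
  then show "fincodim (vecs V) W" using Z subspaceD[OF Z(2)] by (metis subset_antisym)
next
  interpret Q: vector_structure "quotient_space V W" by (rule vector_structure_quotient)
  assume "fincodim (vecs V) W"
  then obtain B where B: "finite B" "B \<subseteq> vecs V"
    "\<And>U. vsubspace V U \<Longrightarrow> W \<subseteq> U \<Longrightarrow> B \<subseteq> U \<Longrightarrow> vecs V \<subseteq> U"
    using fincodim_spanned by (metis order_refl)
  have BQ: "coset W ` B \<subseteq> vecs (quotient_space V W)" using B by (auto simp: quotient_vecs)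
  let ?S = "vspan (quotient_space V W) (coset W ` B)"
  have S: "vsubspace (quotient_space V W) ?S" using Q.subspace_span[OF BQ] .
  have "vsubspace V {x \<in> vecs V. coset W x \<in> ?S}"
    using Q.subspaceD(2-4)[OF S] unfolding vsubspace_def
    by (auto simp: quotient_zero simp flip: quotient_add quotient_scale)
  moreover have "W \<subseteq> {x \<in> vecs V. coset W x \<in> ?S}"
  proof
    fix w assume w: "w \<in> W"
    then have "w \<in> vecs V" "coset W w = coset W (vzero V)"
      using subspaceD[OF W] by (auto simp: coset_eq_iff[OF W])
    then show "w \<in> {x \<in> vecs V. coset W x \<in> ?S}" using Q.subspaceD(2)[OF S] by (auto simp: quotient_zero)
  qed
  moreover have "B \<subseteq> {x \<in> vecs V. coset W x \<in> ?S}" using B(2) Q.span_superset by blast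
  ultimately have "vecs V \<subseteq> {x \<in> vecs V. coset W x \<in> ?S}" using B(3) by blast
  then have "Q.finitely_spanned (vecs (quotient_space V W))"
    unfolding Q.finitely_spanned_def using BQ B(1) by (auto simp: quotient_vecs intro!: exI[of _ "coset W ` B"])
  then show "finite_dim (quotient_space V W)" by (rule Q.finite_dim_if_finitely_spanned)
qed

end

end

subsection \<open>Sublinear and linear functionals\<close>

context vector_structure
begin

text \<open>Homogeneity is demanded as an inequality for positive t only. Applying it to t and to
  1/t yields equality, and the value 0 at the origin.\<close>

definition sublinear :: "('v \<Rightarrow> real) \<Rightarrow> bool" where
  "sublinear q \<longleftrightarrow> (\<forall>x\<in>vecs V. \<forall>y\<in>vecs V. q (x \<oplus> y) \<le> q x + q y) \<and>
     (\<forall>x\<in>vecs V. \<forall>t>0. q (of_real t \<odot> x) \<le> t * q x)"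

lemma sublinearD:
  assumes "sublinear q" "x \<in> vecs V"
  shows "y \<in> vecs V \<Longrightarrow> q (x \<oplus> y) \<le> q x + q y" "q (vzero V) = 0"
    "0 \<le> t \<Longrightarrow> q (of_real t \<odot> x) = t * q x" "- q ((- 1) \<odot> x) \<le> q x"
proof -
  have le: "q (of_real t \<odot> y) \<le> t * q y" if "0 < t" "y \<in> vecs V" for t y
    using assms(1) that by (auto simp: sublinear_def)
  show add: "q (x \<oplus> y) \<le> q x + q y" if "y \<in> vecs V" for y
    using assms that by (auto simp: sublinear_def)
  show zero: "q (vzero V) = 0"
    using le[of 2 "vzero V"] le[of "1/2" "vzero V"] by auto
  show "q (of_real t \<odot> x) = t * q x" if t: "0 \<le> t" for t
  proof (cases "t = 0")
    case True
    then show ?thesis using zero assms(2) by simp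
  next
    case False
    have "q x \<le> (1 / t) * q (of_real t \<odot> x)"
      using le[of "1 / t" "of_real t \<odot> x"] t False assms(2) by simp
    then show ?thesis using le[of t x] t False assms(2) by (auto simp: field_simps)
  qed
  show "- q ((- 1) \<odot> x) \<le> q x"
    using add[of "(- 1) \<odot> x"] zero assms(2) by simp
qed

text \<open>The functional is the infimum of q (z + t c) - t \<delta> over t >= 0 and c in C. A
  linear u below it is at least \<delta> on C, because u (- c) <= q' (- c) <= - \<delta>. The
  construction serves both the existence of linear minorants, with C a single point, and the
  separation of a point from a convex set.\<close>

lemma sublinear_tilt:
  assumes q: "sublinear q" and C: "C \<subseteq> vecs V" "C \<noteq> {}" "vconvex V C"
    and \<delta>: "\<And>c. c \<in> C \<Longrightarrow> \<delta> \<le> q c"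
  obtains q' where "sublinear q'" "\<And>x. x \<in> vecs V \<Longrightarrow> q' x \<le> q x"
    "\<And>c. c \<in> C \<Longrightarrow> q' ((- 1) \<odot> c) \<le> - \<delta>"
proof
  define S where "S z = {q (z \<oplus> of_real t \<odot> c) - t * \<delta> | t c. 0 \<le> t \<and> c \<in> C}" for z
  define q' where "q' z = Inf (S z)" for z
  have CV [simp]: "c \<in> vecs V" if "c \<in> C" for c using that C by auto
  obtain c0 where c0: "c0 \<in> C" using C by auto
  have ne: "S z \<noteq> {}" for z using c0 unfolding S_def by (auto intro: exI[of _ 0])
  \<comment> \<open>The lower bound - q (- z) comes from t \<delta> <= q (t c) <= q (z + t c) + q (-
    z).\<close>
  have bdd: "bdd_below (S z)" if z: "z \<in> vecs V" for z
  proof (rule bdd_belowI)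
    fix r assume "r \<in> S z"
    then obtain t c where r: "r = q (z \<oplus> of_real t \<odot> c) - t * \<delta>" "0 \<le> t" "c \<in> C"
      unfolding S_def by auto
    have "t * \<delta> \<le> t * q c" using \<delta> r by (intro mult_left_mono) auto
    also have "\<dots> = q (of_real t \<odot> c)" using sublinearD(3)[OF q, of c t] r by simp
    also have "\<dots> = q ((z \<oplus> of_real t \<odot> c) \<ominus> z)"
      using z r by (simp add: add_ac)
    also have "\<dots> \<le> q (z \<oplus> of_real t \<odot> c) + q ((- 1) \<odot> z)"
      using z r by (intro sublinearD(1)[OF q]) auto
    finally show "- q ((- 1) \<odot> z) \<le> r" using r by simp
  qed
  have le: "q' z \<le> q (z \<oplus> of_real t \<odot> c) - t * \<delta>" if "z \<in> vecs V" "0 \<le> t" "c \<in> C" for z t c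
    unfolding q'_def by (intro cInf_lower bdd) (use that in \<open>auto simp: S_def\<close>)
  have ge: "r \<le> q' z" if "\<And>t c. 0 \<le> t \<Longrightarrow> c \<in> C \<Longrightarrow> r \<le> q (z \<oplus> of_real t \<odot> c) - t * \<delta>" for r z
    unfolding q'_def by (intro cInf_greatest ne) (use that in \<open>auto simp: S_def\<close>)
  show "q' x \<le> q x" if "x \<in> vecs V" for x using le[of x 0 c0] that c0 by simp
  show "q' ((- 1) \<odot> c) \<le> - \<delta>" if "c \<in> C" for c
    using le[of "(- 1) \<odot> c" 1 c] that sublinearD(2)[OF q, of c] by simp
  show "sublinear q'"
    unfolding sublinear_def
  proof (intro conjI ballI allI impI)
    fix x y assume [simp]: "x \<in> vecs V" "y \<in> vecs V"
    \<comment> \<open>Competitors for x and for y merge into one for x + y: by convexity C contains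
      a point e with (t + s) e = t c + s d.\<close>
    have *: "q' (x \<oplus> y) \<le> (q (x \<oplus> of_real t \<odot> c) - t * \<delta>) + (q (y \<oplus> of_real s \<odot> d) - s * \<delta>)"
      if tc: "0 \<le> t" "c \<in> C" "0 \<le> s" "d \<in> C" for t c s d
    proof (cases "t + s = 0")
      case True
      then have "t = 0" "s = 0" using tc by auto
      then show ?thesis using le[of "x \<oplus> y" 0 c] tc sublinearD(1)[OF q, of x y] by simp
    next
      case False
      then have ts: "0 < t + s" using tc by auto
      define r where "r = s / (t + s)"
      have r: "0 \<le> r" "r \<le> 1" using tc ts by (auto simp: r_def)
      have r1: "(t + s) * r = s" "(t + s) * (1 - r) = t" using ts by (auto simp: r_def field_simps)
      define e where "e = of_real (1 - r) \<odot> c \<oplus> of_real r \<odot> d"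
      have e: "e \<in> C" using C(3) r tc unfolding vconvex_def e_def by blast
      have "q' (x \<oplus> y) \<le> q ((x \<oplus> y) \<oplus> of_real (t + s) \<odot> e) - (t + s) * \<delta>"
        using ts e by (intro le) auto
      also have "of_real (t + s) \<odot> e = of_real t \<odot> c \<oplus> of_real s \<odot> d"
        unfolding e_def using tc
        by (simp add: scale_add r1 del: of_real_add of_real_diff flip: of_real_mult)
      also have "(x \<oplus> y) \<oplus> (of_real t \<odot> c \<oplus> of_real s \<odot> d)
          = (x \<oplus> of_real t \<odot> c) \<oplus> (y \<oplus> of_real s \<odot> d)"
        using tc by (simp add: add_ac)
      also have "q \<dots> \<le> q (x \<oplus> of_real t \<odot> c) + q (y \<oplus> of_real s \<odot> d)"
        using tc by (intro sublinearD(1)[OF q]) auto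
      finally show ?thesis by (simp add: algebra_simps)
    qed
    have "q' (x \<oplus> y) - (q (y \<oplus> of_real s \<odot> d) - s * \<delta>) \<le> q' x" if "0 \<le> s" "d \<in> C" for s d
      by (intro ge) (use *[OF _ _ that] in \<open>auto simp: algebra_simps\<close>)
    then have "q' (x \<oplus> y) - q' x \<le> q' y"
      by (intro ge) (auto simp: algebra_simps)
    then show "q' (x \<oplus> y) \<le> q' x + q' y" by simp
  next
    fix x and t :: real assume [simp]: "x \<in> vecs V" and t: "0 < t"
    have "q' (of_real t \<odot> x) / t \<le> q' x"
    proof (rule ge)
      fix s :: real and c assume sc: "0 \<le> s" "c \<in> C"
      have "q' (of_real t \<odot> x) \<le> q (of_real t \<odot> x \<oplus> of_real (t * s) \<odot> c) - (t * s) * \<delta>"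
        using sc t by (intro le) auto
      also have "of_real t \<odot> x \<oplus> of_real (t * s) \<odot> c = of_real t \<odot> (x \<oplus> of_real s \<odot> c)"
        using sc by (simp add: scale_add)
      also have "q \<dots> = t * q (x \<oplus> of_real s \<odot> c)"
        using sc t by (intro sublinearD(3)[OF q]) auto
      finally show "q' (of_real t \<odot> x) / t \<le> q (x \<oplus> of_real s \<odot> c) - s * \<delta>"
        using t by (simp add: field_simps)
    qed
    then show "q' (of_real t \<odot> x) \<le> t * q' x" using t by (simp add: field_simps)
  qed
qed

text \<open>Over the complex field such a functional takes the place of the real part of a linear
  functional.\<close>

definition real_linear :: "('v \<Rightarrow> real) \<Rightarrow> bool" where
  "real_linear u \<longleftrightarrow> (\<forall>x\<in>vecs V. \<forall>y\<in>vecs V. u (x \<oplus> y) = u x + u y) \<and>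
     (\<forall>x\<in>vecs V. \<forall>t. u (of_real t \<odot> x) = t * u x)"

text \<open>A pointwise minimal sublinear functional is linear, by \<open>sublinear_tilt\<close> with a singleton.\<close>

lemma sublinear_dominates_linear:
  assumes q: "sublinear q"
  obtains u where "real_linear u" "\<And>x. x \<in> vecs V \<Longrightarrow> u x \<le> q x"
proof -
  \<comment> \<open>Values off the carrier are pinned to 0, so that the order on functions compares
    values on the carrier only.\<close>
  define A where "A = {f. sublinear f \<and> (\<forall>x\<in>vecs V. f x \<le> q x) \<and> (\<forall>x. x \<notin> vecs V \<longrightarrow> f x = 0)}"
  define restr where "restr f x = (if x \<in> vecs V then f x else 0)" for f :: "'v \<Rightarrow> real" and x
  have restr: "restr f \<in> A" if "sublinear f" "\<And>x. x \<in> vecs V \<Longrightarrow> f x \<le> q x" for f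
    using that by (auto simp: A_def restr_def sublinear_def)
  have "\<exists>m\<in>A. \<forall>a\<in>A. a \<le> m \<longrightarrow> a = m"
  proof (rule predicate_Zorn)
    show "partial_order_on A (relation_of (\<lambda>f g. g \<le> f) A)"
      by (rule partial_order_on_relation_ofI) auto
  next
    fix C assume "C \<in> Chains (relation_of (\<lambda>f g. g \<le> f) A)"
    then have CA: "\<And>f. f \<in> C \<Longrightarrow> f \<in> A" and chain: "\<And>f g. f \<in> C \<Longrightarrow> g \<in> C \<Longrightarrow> f \<le> g \<or> g \<le> f"
      by (auto simp: Chains_def relation_of_def)
    show "\<exists>u\<in>A. \<forall>a\<in>C. u \<le> a"
    proof (cases "C = {}")
      case True
      then show ?thesis using restr[OF q] by auto
    next
      case False
      define i where "i x = (INF f\<in>C. f x)" for x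
      have bdd: "bdd_below ((\<lambda>f. f x) ` C)" if x: "x \<in> vecs V" for x
      proof (rule bdd_belowI2)
        fix f assume "f \<in> C"
        then have "f \<in> A" using CA by auto
        then show "- q ((- 1) \<odot> x) \<le> f x"
          using sublinearD(4)[of f x] x unfolding A_def mem_Collect_eq by (smt (verit) scale_closed)
      qed
      have le: "i x \<le> f x" if "x \<in> vecs V" "f \<in> C" for x f
        unfolding i_def using that bdd by (intro cINF_lower) auto
      have ge: "r \<le> i x" if "\<And>f. f \<in> C \<Longrightarrow> r \<le> f x" for r x
        unfolding i_def using that False by (intro cINF_greatest) auto
      obtain f0 where f0: "f0 \<in> C" using False by auto
      have "sublinear i"
        unfolding sublinear_def
      proof (intro conjI ballI allI impI)
        fix x y assume xy: "x \<in> vecs V" "y \<in> vecs V"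
        \<comment> \<open>The chain supplies an h below both f and g, so the two infima may be taken
          independently.\<close>
        have *: "i (x \<oplus> y) \<le> f x + g y" if fg: "f \<in> C" "g \<in> C" for f g
        proof -
          obtain h where h: "h \<in> C" "h \<le> f" "h \<le> g" using chain[OF fg] fg by blast
          have "i (x \<oplus> y) \<le> h (x \<oplus> y)" using xy h by (intro le) auto
          also have "\<dots> \<le> h x + h y" using CA[OF h(1)] xy by (auto simp: A_def sublinear_def)
          also have "\<dots> \<le> f x + g y" using h by (intro add_mono) (auto simp: le_fun_def)
          finally show ?thesis .
        qed
        have "i (x \<oplus> y) - g y \<le> i x" if "g \<in> C" for g
          by (intro ge) (use *[OF _ that] in \<open>auto simp: algebra_simps\<close>)
        then have "i (x \<oplus> y) - i x \<le> i y" by (intro ge) (auto simp: algebra_simps)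
        then show "i (x \<oplus> y) \<le> i x + i y" by simp
      next
        fix x and t :: real assume x: "x \<in> vecs V" and t: "0 < t"
        have "i (of_real t \<odot> x) / t \<le> i x"
        proof (rule ge)
          fix f assume f: "f \<in> C"
          have "i (of_real t \<odot> x) \<le> f (of_real t \<odot> x)" using f x by (intro le) auto
          also have "\<dots> \<le> t * f x" using CA[OF f] x t by (auto simp: A_def sublinear_def)
          finally show "i (of_real t \<odot> x) / t \<le> f x" using t by (simp add: field_simps)
        qed
        then show "i (of_real t \<odot> x) \<le> t * i x" using t by (simp add: field_simps)
      qed
      moreover have "i x \<le> q x" if x: "x \<in> vecs V" for x
        using le[OF x f0] CA[OF f0] x by (fastforce simp: A_def)
      ultimately have "restr i \<in> A" by (rule restr)
      moreover have "restr i \<le> f" if "f \<in> C" for f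
        using le[OF _ that] CA[OF that] by (auto simp: restr_def le_fun_def A_def)
      ultimately show ?thesis by blast
    qed
  qed
  then obtain m where m: "m \<in> A" and min: "\<And>a. a \<in> A \<Longrightarrow> a \<le> m \<Longrightarrow> a = m" by blast
  have sm: "sublinear m" using m by (simp add: A_def)
  \<comment> \<open>Tilting m along y with level m y gives a minorant of m, which is m itself by
    minimality. Hence m (- y) <= - m y; the reverse inequality is subadditivity.\<close>
  have neg: "m ((- 1) \<odot> y) = - m y" if y: "y \<in> vecs V" for y
  proof -
    have "vconvex V {y}"
      using y by (auto simp: vconvex_def simp flip: add_scale)
    then obtain q' where q': "sublinear q'" "\<And>x. x \<in> vecs V \<Longrightarrow> q' x \<le> m x" "q' ((- 1) \<odot> y) \<le> - m y"
      using sublinear_tilt[OF sm, of "{y}" "m y"] y by auto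
    have "restr q' \<in> A" using q' m by (intro restr) (force simp: A_def)+
    moreover have "restr q' \<le> m" using q' m by (auto simp: restr_def le_fun_def A_def)
    ultimately have "restr q' = m" by (rule min)
    then have "m ((- 1) \<odot> y) = q' ((- 1) \<odot> y)" using y by (auto simp: restr_def)
    then show ?thesis using q'(3) sublinearD(4)[OF sm y] by simp
  qed
  have "real_linear m"
    unfolding real_linear_def
  proof (intro conjI ballI allI)
    fix x y assume xy [simp]: "x \<in> vecs V" "y \<in> vecs V"
    have "m x = m (x \<oplus> y \<ominus> y)" by simp
    also have "\<dots> \<le> m (x \<oplus> y) + m ((- 1) \<odot> y)" by (intro sublinearD(1)[OF sm]) auto
    finally show "m (x \<oplus> y) = m x + m y"
      using neg[of y] sublinearD(1)[OF sm xy] by simp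
  next
    fix x and t :: real assume x: "x \<in> vecs V"
    show "m (of_real t \<odot> x) = t * m x"
    proof (cases "0 \<le> t")
      case True
      then show ?thesis using sublinearD(3)[OF sm x] by simp
    next
      case False
      then have "m (of_real (- t) \<odot> x) = - t * m x" by (intro sublinearD(3)[OF sm x]) simp
      then show ?thesis using neg[of "of_real t \<odot> x"] x by simp
    qed
  qed
  moreover have "m x \<le> q x" if "x \<in> vecs V" for x using m that by (auto simp: A_def)
  ultimately show thesis by (rule that)
qed

lemma real_linearD:
  assumes "real_linear u"
  shows "\<lbrakk>x \<in> vecs V; y \<in> vecs V\<rbrakk> \<Longrightarrow> u (x \<oplus> y) = u x + u y"
    "x \<in> vecs V \<Longrightarrow> u (of_real t \<odot> x) = t * u x" "x \<in> vecs V \<Longrightarrow> u ((- 1) \<odot> x) = - u x"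
    "u (vzero V) = 0"
proof -
  show add: "\<lbrakk>x \<in> vecs V; y \<in> vecs V\<rbrakk> \<Longrightarrow> u (x \<oplus> y) = u x + u y" for x y
    using assms by (simp add: real_linear_def)
  show sc: "x \<in> vecs V \<Longrightarrow> u (of_real t \<odot> x) = t * u x" for x t
    using assms by (simp add: real_linear_def)
  show "x \<in> vecs V \<Longrightarrow> u ((- 1) \<odot> x) = - u x" using sc[of x "-1"] by simp
  show "u (vzero V) = 0" using add[of "vzero V" "vzero V"] by simp
qed

text \<open>The largest subspace over \<open>'k\<close> on which u vanishes. For complex scalars it
  is the kernel of the complex-linear functional with real part u.\<close>

definition scalar_kernel :: "('v \<Rightarrow> real) \<Rightarrow> 'v set" where
  "scalar_kernel u = {h \<in> vecs V. \<forall>c. u (c \<odot> h) = 0}"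

lemma subspace_scalar_kernel: "real_linear u \<Longrightarrow> vsubspace V (scalar_kernel u)"
  by (auto simp: vsubspace_def scalar_kernel_def real_linearD scale_add)

end

locale euclidean_vector_structure =
  vector_structure V for V :: "('k::{real_normed_field,euclidean_space}, 'v, 'z) vspace_scheme"
begin

text \<open>The scalar g w represents the real-linear form sending d to u (d w), with respect to the
  inner product of the scalar field. For b outside the kernel, c maps to g (c b) injectively, hence
  onto, as the field is finite-dimensional over the reals. So every z agrees with some multiple of b
  modulo the kernel, and the codimension over \<open>'k\<close> is at most one.\<close>

lemma fincodim_scalar_kernel:
  assumes u: "real_linear u"
  shows "fincodim (vecs V) (scalar_kernel u)"
proof (cases "vecs V \<subseteq> scalar_kernel u")
  case True
  then have "vecs V = scalar_kernel u" by (auto simp: scalar_kernel_def)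
  then show ?thesis by simp
next
  case False
  then obtain b where b [simp]: "b \<in> vecs V" and bn: "b \<notin> scalar_kernel u" by auto
  define g where "g w = (\<Sum>i\<in>Basis. u (i \<odot> w) *\<^sub>R i)" for w
  have usum: "finite I \<Longrightarrow> u ((\<Sum>i\<in>I. f i) \<odot> w) = (\<Sum>i\<in>I. u (f i \<odot> w))"
    if "w \<in> vecs V" for w and f :: "'k \<Rightarrow> 'k" and I
    by (induction I rule: finite_induct) (use that in \<open>auto simp: add_scale real_linearD[OF u]\<close>)
  have g: "inner d (g w) = u (d \<odot> w)" if w: "w \<in> vecs V" for d w
  proof -
    have "u (d \<odot> w) = u ((\<Sum>i\<in>Basis. inner d i *\<^sub>R i) \<odot> w)" by (simp add: euclidean_representation)
    also have "\<dots> = (\<Sum>i\<in>Basis. u ((inner d i *\<^sub>R i) \<odot> w))" using w by (simp add: usum)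
    also have "\<dots> = (\<Sum>i\<in>Basis. u (of_real (inner d i) \<odot> (i \<odot> w)))"
      using w by (simp add: scaleR_conv_of_real)
    also have "\<dots> = (\<Sum>i\<in>Basis. inner d i * u (i \<odot> w))"
      using w by (simp add: real_linearD[OF u] del: scale_scale)
    also have "\<dots> = inner d (g w)" by (simp add: g_def inner_sum_right mult.commute)
    finally show ?thesis by simp
  qed
  define T where "T c = g (c \<odot> b)" for c
  have "linear T"
  proof (rule linearI; rule vector_eq_ldot[THEN iffD1]; intro allI)
    fix c d x show "inner x (T (c + d)) = inner x (T c + T d)"
      by (simp add: T_def g inner_right_distrib add_scale scale_add real_linearD[OF u] del: scale_scale)
  next
    fix r c x show "inner x (T (r *\<^sub>R c)) = inner x (r *\<^sub>R T c)"
      using real_linearD(2)[OF u, of "x \<odot> c \<odot> b" r]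
      by (simp add: T_def g inner_scaleR_right mult_ac) (simp add: scaleR_conv_of_real mult_ac)
  qed
  \<comment> \<open>A nonzero c with T c = 0 would give u (d b) = inner (d / c) (T c) = 0 for every
    d, placing b in the kernel.\<close>
  moreover have "inj T"
  proof (subst linear_injective_0[OF \<open>linear T\<close>], intro allI impI, rule ccontr)
    fix c assume "T c = 0" "c \<noteq> 0"
    have "u (d \<odot> b) = 0" for d
      using g[of "c \<odot> b" "d / c"] \<open>T c = 0\<close> \<open>c \<noteq> 0\<close> by (simp add: T_def)
    then show False using bn by (simp add: scalar_kernel_def)
  qed
  ultimately have "surj T" by (rule eucl.linear_inj_imp_surj)
  have "\<exists>c. z \<ominus> c \<odot> b \<in> scalar_kernel u" if z: "z \<in> vecs V" for z
  proof -
    obtain c where "g z = T c" using \<open>surj T\<close> by (metis surjD)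
    then have "u (d \<odot> z) = u (d \<odot> c \<odot> b)" for d
      using g[OF z, of d] g[of "c \<odot> b" d] by (simp add: T_def)
    then have "u (d \<odot> (z \<ominus> c \<odot> b)) = 0" for d
      using z real_linearD(3)[OF u, of "d \<odot> c \<odot> b"] by (simp add: scale_add real_linearD[OF u])
    then show ?thesis using z by (auto simp: scalar_kernel_def intro!: exI[of _ c])
  qed
  then have "codim1 (vecs V) (scalar_kernel u)"
    unfolding codim1_def using subspace_scalar_kernel[OF u]
    by (auto simp: scalar_kernel_def intro!: bexI[of _ b])
  then show ?thesis by blast
qed

end

subsection \<open>Normed spaces on a carrier\<close>

locale normed_structure =
  vector_structure X for X :: "('k::real_normed_field, 'v, 'z) nspace_scheme" +
  assumes norm: "is_norm X (vnorm X)"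
begin

abbreviation nadd (infixl "\<oplus>" 65) where "x \<oplus> y \<equiv> vadd X x y"
abbreviation nscale (infixr "\<odot>" 75) where "c \<odot> x \<equiv> vscale X c x"
abbreviation nsub (infixl "\<ominus>" 65) where "x \<ominus> y \<equiv> vadd X x (vscale X (- 1) y)"

lemma norm_nonneg [simp]: "x \<in> vecs X \<Longrightarrow> 0 \<le> vnorm X x"
  and norm_eq_0_iff [simp]: "x \<in> vecs X \<Longrightarrow> vnorm X x = 0 \<longleftrightarrow> x = vzero X"
  and norm_scale [simp]: "x \<in> vecs X \<Longrightarrow> vnorm X (c \<odot> x) = norm c * vnorm X x"
  and norm_triangle: "x \<in> vecs X \<Longrightarrow> y \<in> vecs X \<Longrightarrow> vnorm X (x \<oplus> y) \<le> vnorm X x + vnorm X y"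
  using norm by (auto simp: is_norm_def)

lemma norm_zero [simp]: "vnorm X (vzero X) = 0"
  by simp

lemma norm_sub_commute:
  assumes [simp]: "x \<in> vecs X" "y \<in> vecs X"
  shows "vnorm X (x \<ominus> y) = vnorm X (y \<ominus> x)"
proof -
  have "x \<ominus> y = (- 1) \<odot> (y \<ominus> x)" by (simp add: scale_add add_commute)
  then have "vnorm X (x \<ominus> y) = vnorm X ((- 1) \<odot> (y \<ominus> x))" by simp
  then show ?thesis by (subst (asm) norm_scale) auto
qed

lemma norm_sub_triangle:
  assumes [simp]: "x \<in> vecs X" "y \<in> vecs X" "z \<in> vecs X"
  shows "vnorm X (x \<ominus> z) \<le> vnorm X (x \<ominus> y) + vnorm X (y \<ominus> z)"
proof -
  have "x \<ominus> z = (x \<ominus> y) \<oplus> (y \<ominus> z)" by (simp add: add_ac)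
  then show ?thesis using norm_triangle[of "x \<ominus> y" "y \<ominus> z"] by simp
qed

section \<open>Metric, closed sets and closed finite-codimensional subspaces\<close>

lemma metric_space: "Metric_space (vecs X) (ndist X)"
proof
  show "ndist X x y = 0 \<longleftrightarrow> x = y" if "x \<in> vecs X" "y \<in> vecs X" for x y
    using that sub_eq_zero[of x y] by (auto simp: ndist_def)
  show "ndist X x z \<le> ndist X x y + ndist X y z" if "x \<in> vecs X" "y \<in> vecs X" "z \<in> vecs X" for x y z
    using that norm_sub_triangle by (auto simp: ndist_def)
qed (auto simp: ndist_def norm_sub_commute)

text \<open>Distance form of closedness, in which kernels, separation, renorming and slabs use
  it.\<close>

lemma norm_closed_iff:
  "norm_closed X A \<longleftrightarrow> A \<subseteq> vecs X \<and>
     (\<forall>x\<in>vecs X - A. \<exists>r>0. \<forall>a\<in>A. r \<le> vnorm X (a \<ominus> x))"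
proof -
  interpret M: Metric_space "vecs X" "ndist X" by (rule metric_space)
  have "disjnt A (M.mball x r) \<longleftrightarrow> (\<forall>a\<in>A. r \<le> vnorm X (a \<ominus> x))"
    if "A \<subseteq> vecs X" "x \<in> vecs X" for x r
    using that norm_sub_commute[of x] by (force simp: disjnt_iff ndist_def)
  then show ?thesis
    unfolding norm_closed_def M.closedin_metric by (metis (no_types, lifting) DiffE)
qed

lemma norm_closed_carrier [simp]: "norm_closed X (vecs X)"
  by (auto simp: norm_closed_iff)

lemma norm_closed_Int: "norm_closed X A \<Longrightarrow> norm_closed X B \<Longrightarrow> norm_closed X (A \<inter> B)"
  by (auto simp: norm_closed_def)

lemma closed_fincodim_iff:
  "closed_fincodim_subspace X Y \<longleftrightarrow>
     vsubspace X Y \<and> norm_closed X Y \<and> fincodim (vecs X) Y"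
  by (auto simp: closed_fincodim_subspace_def finite_dim_quotient_iff)

lemma closed_fincodim_carrier [simp]: "closed_fincodim_subspace X (vecs X)"
  by (simp add: closed_fincodim_iff)

lemma closed_fincodim_Int:
  assumes "closed_fincodim_subspace X Y" "closed_fincodim_subspace X Z"
  shows "closed_fincodim_subspace X (Y \<inter> Z)"
  using assms
  by (auto simp: closed_fincodim_iff intro: subspace_Int norm_closed_Int fincodim_Int_carrier)

text \<open>Finitely many generators of Y, together with the finitely many vectors of a chain down
  to Y, would generate X. This supplies the condition that Y is infinite-dimensional when an
  essential inradius is bounded from below.\<close>

lemma not_finite_dim_closed_fincodim:
  assumes "closed_fincodim_subspace X Y" "\<not> finite_dim X"
  shows "\<not> finite_dim (X\<lparr>vecs := Y\<rparr>)"
  using assms finitely_spanned_if_finite_dim finitely_spanned_fincodim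
    finite_dim_if_finitely_spanned
  by (metis closed_fincodim_iff order_refl)

text \<open>If u (c x) is nonzero, every a in the kernel satisfies |u (c x)| = |u (c (a - x))| <=
  |c| times the norm of a - x, which bounds the distance from x from below.\<close>

lemma closed_scalar_kernel:
  assumes u: "real_linear u" and le: "\<And>x. x \<in> vecs X \<Longrightarrow> u x \<le> vnorm X x"
  shows "norm_closed X (scalar_kernel u)"
  unfolding norm_closed_iff
proof (intro conjI ballI)
  have abs: "\<bar>u x\<bar> \<le> vnorm X x" if "x \<in> vecs X" for x
    using le[OF that] le[of "(- 1) \<odot> x"] that by (simp add: real_linearD[OF u])
  fix x assume "x \<in> vecs X - scalar_kernel u"
  then obtain c where x [simp]: "x \<in> vecs X" and c: "u (c \<odot> x) \<noteq> 0"
    by (auto simp: scalar_kernel_def)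
  have c0: "c \<noteq> 0" using c real_linearD(4)[OF u] by auto
  show "\<exists>r>0. \<forall>a\<in>scalar_kernel u. r \<le> vnorm X (a \<ominus> x)"
  proof (intro exI[of _ "\<bar>u (c \<odot> x)\<bar> / norm c"] conjI ballI)
    fix a assume a: "a \<in> scalar_kernel u"
    then have [simp]: "a \<in> vecs X" by (simp add: scalar_kernel_def)
    have "u (c \<odot> (a \<ominus> x)) = u (c \<odot> a) - u (c \<odot> x)"
      using real_linearD(3)[OF u, of "c \<odot> x"] by (simp add: scale_add real_linearD[OF u])
    also have "u (c \<odot> a) = 0" using a by (simp add: scalar_kernel_def)
    finally have "\<bar>u (c \<odot> x)\<bar> \<le> vnorm X (c \<odot> (a \<ominus> x))"
      using abs[of "c \<odot> (a \<ominus> x)"] by simp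
    also have "\<dots> = norm c * vnorm X (a \<ominus> x)" by (rule norm_scale) simp
    finally show "\<bar>u (c \<odot> x)\<bar> / norm c \<le> vnorm X (a \<ominus> x)"
      using c0 by (simp add: field_simps)
  qed (use c c0 in auto)
qed (auto simp: scalar_kernel_def)

end

section \<open>Separation of a point from a closed convex set\<close>

locale euclidean_normed_structure =
  normed_structure X for X :: "('k::{real_normed_field,euclidean_space}, 'v, 'z) nspace_scheme"
begin

sublocale euclidean_vector_structure X ..

text \<open>The norm is at least some \<delta> > 0 on the convex set A - x. Tilting it along this
  set and taking a linear minorant u gives u >= \<delta> on A - x, while u vanishes on its scalar
  kernel H.\<close>

lemma separation:
  assumes A: "A \<subseteq> vecs X" "norm_closed X A" "vconvex X A" and x: "x \<in> vecs X" "x \<notin> A"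
  obtains H where "closed_fincodim_subspace X H" "\<And>h. h \<in> H \<Longrightarrow> x \<oplus> h \<notin> A"
proof (cases "A = {}")
  case True
  then show thesis using that[of "vecs X"] by simp
next
  case False
  note [simp] = x(1)
  have AV [simp]: "a \<in> vecs X" if "a \<in> A" for a using A that by auto
  obtain \<delta> where \<delta>: "0 < \<delta>" "\<And>a. a \<in> A \<Longrightarrow> \<delta> \<le> vnorm X (a \<ominus> x)"
    using A(2) x unfolding norm_closed_iff by blast
  let ?C = "(\<lambda>a. a \<ominus> x) ` A"
  have "sublinear (vnorm X)" by (auto simp: sublinear_def norm_triangle)
  moreover have "vconvex X ?C"
    unfolding vconvex_def
  proof (intro ballI allI impI)
    fix v w and t :: real assume "v \<in> ?C" "w \<in> ?C" and t: "0 \<le> t \<and> t \<le> 1"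
    then obtain a b where ab: "a \<in> A" "b \<in> A" and vw: "v = a \<ominus> x" "w = b \<ominus> x" by auto
    have c: "of_real (1 - t) \<odot> a \<oplus> of_real t \<odot> b \<in> A" (is "?c \<in> A")
      using A ab t by (auto simp: vconvex_def)
    have "of_real (1 - t) \<odot> v \<oplus> of_real t \<odot> w
        = ?c \<oplus> ((- of_real (1 - t)) \<odot> x \<oplus> (- of_real t) \<odot> x)"
      using ab by (simp add: vw scale_add add_ac del: of_real_diff)
    also have "(- of_real (1 - t)) \<odot> x \<oplus> (- of_real t) \<odot> x = (- 1) \<odot> x"
      by (simp flip: add_scale)
    finally show "of_real (1 - t) \<odot> v \<oplus> of_real t \<odot> w \<in> ?C" using c by blast
  qed
  moreover have "?C \<subseteq> vecs X" "?C \<noteq> {}" using False by auto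
  moreover have "\<delta> \<le> vnorm X c" if "c \<in> ?C" for c using \<delta> that by auto
  ultimately obtain q' where q': "sublinear q'" "\<And>z. z \<in> vecs X \<Longrightarrow> q' z \<le> vnorm X z"
    "\<And>c. c \<in> ?C \<Longrightarrow> q' ((- 1) \<odot> c) \<le> - \<delta>"
    using sublinear_tilt[of "vnorm X" ?C \<delta>] by blast
  obtain u where u: "real_linear u" and le: "\<And>z. z \<in> vecs X \<Longrightarrow> u z \<le> q' z"
    using sublinear_dominates_linear[OF q'(1)] by blast
  have ule: "u z \<le> vnorm X z" if "z \<in> vecs X" for z using le q'(2) that by fastforce
  show thesis
  proof (rule that)
    show "closed_fincodim_subspace X (scalar_kernel u)"
      unfolding closed_fincodim_iff
      using closed_scalar_kernel[OF u ule] subspace_scalar_kernel[OF u] fincodim_scalar_kernel[OF u]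
      by blast
  next
    fix h assume h: "h \<in> scalar_kernel u"
    then have hV [simp]: "h \<in> vecs X" and "u (1 \<odot> h) = 0"
      unfolding scalar_kernel_def by blast+
    then have uh: "u h = 0" by simp
    show "x \<oplus> h \<notin> A"
    proof
      assume a: "x \<oplus> h \<in> A"
      have "q' ((- 1) \<odot> ((x \<oplus> h) \<ominus> x)) \<le> - \<delta>" using q'(3) a by blast
      then have "q' ((- 1) \<odot> h) \<le> - \<delta>" by (simp add: add_ac)
      then show False using le[of "(- 1) \<odot> h"] \<delta>(1) uh by (simp add: real_linearD[OF u])
    qed
  qed
qed

end

subsection \<open>The lower bound\<close>

context normed_structure
begin

section \<open>Change of norm, and the gain in one smoothness step\<close>

lemma normed_structure_renorm:
  assumes "is_norm X N"
  shows "normed_structure (X\<lparr>vnorm := N\<rparr>)"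
proof unfold_locales
  show "is_norm (X\<lparr>vnorm := N\<rparr>) (vnorm (X\<lparr>vnorm := N\<rparr>))"
    using assms by (simp add: is_norm_def)
qed (auto simp: add_ac scale_add add_scale)

text \<open>Codimension does not see the norm, and a distance r with respect to N is a distance at
  least r / b in the original norm.\<close>

lemma closed_fincodim_renorm:
  assumes N: "is_norm X N" and b: "0 < b" "\<And>x. x \<in> vecs X \<Longrightarrow> N x \<le> b * vnorm X x"
    and Y: "closed_fincodim_subspace (X\<lparr>vnorm := N\<rparr>) Y"
  shows "closed_fincodim_subspace X Y"
proof -
  interpret N: normed_structure "X\<lparr>vnorm := N\<rparr>" using normed_structure_renorm[OF N] .
  have "norm_closed (X\<lparr>vnorm := N\<rparr>) Y" using Y by (simp add: closed_fincodim_subspace_def)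
  then have YV: "Y \<subseteq> vecs X"
    and cl: "\<And>x. x \<in> vecs X - Y \<Longrightarrow> \<exists>r>0. \<forall>a\<in>Y. r \<le> N (a \<ominus> x)"
    by (auto simp: N.norm_closed_iff)
  have "norm_closed X Y"
    unfolding norm_closed_iff
  proof (intro conjI ballI YV)
    fix x assume x: "x \<in> vecs X - Y"
    then obtain r where r: "r > 0" "\<And>a. a \<in> Y \<Longrightarrow> r \<le> N (a \<ominus> x)" using cl by blast
    have "r / b \<le> vnorm X (a \<ominus> x)" if "a \<in> Y" for a
    proof -
      have "a \<ominus> x \<in> vecs X" using that x YV by auto
      then have "r \<le> b * vnorm X (a \<ominus> x)" using r(2)[OF that] b(2) by fastforce
      then show ?thesis using b(1) by (simp add: field_simps)
    qed
    then show "\<exists>r>0. \<forall>a\<in>Y. r \<le> vnorm X (a \<ominus> x)"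
      using r b(1) by (intro exI[of _ "r / b"]) auto
  qed
  then show ?thesis
    using Y by (auto simp: closed_fincodim_subspace_def quotient_space_def vsubspace_def)
qed

text \<open>Removes the normalisation from the modulus: x may have any norm up to v and y any norm
  up to s. The modulus at t = s / v bounds v x' + s y' by P for the unit vectors x', y' in the
  directions of x and y; smaller vectors follow by splitting off a common multiple of this
  sum.\<close>

lemma AUS_step:
  assumes C: "0 < C" "\<And>t. 0 < t \<Longrightarrow> asymptotic_smoothness X t \<le> ereal (C * t powr p)"
    and x [simp]: "x \<in> vecs X" and v: "vnorm X x \<le> v" and s: "0 < s" "s \<le> v"
  obtains Y where "closed_fincodim_subspace X Y"
    "\<And>y. y \<in> Y \<Longrightarrow> vnorm X y \<le> s \<Longrightarrow> vnorm X (x \<oplus> y) \<le> v * (1 + (C + 1) * (s / v) powr p)"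
proof (cases "x = vzero X")
  case True
  show thesis
  proof (rule that)
    fix y assume y: "y \<in> vecs X" "vnorm X y \<le> s"
    have "v * 1 \<le> v * (1 + (C + 1) * (s / v) powr p)"
      using s C by (intro mult_left_mono) auto
    moreover have "vnorm X (x \<oplus> y) = vnorm X y" using y True by simp
    ultimately show "vnorm X (x \<oplus> y) \<le> v * (1 + (C + 1) * (s / v) powr p)" using s y by linarith
  qed simp
next
  case False
  define t where "t = s / v"
  have t: "0 < t" using s by (simp add: t_def)
  define P where "P = v * (1 + (C + 1) * t powr p)"
  have v0: "0 < v" using s by simp
  have nx: "0 < vnorm X x" using False by (metis less_eq_real_def norm_eq_0_iff norm_nonneg x)
  define x' where "x' = of_real (1 / vnorm X x) \<odot> x"
  have x' [simp]: "x' \<in> vecs X" by (simp add: x'_def)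
  have "vnorm X x' = 1" using nx by (auto simp: x'_def norm_divide)
  then have x'S: "x' \<in> unit_sphere X" by (simp add: unit_sphere_def)
  have "(INF Y\<in>{Y. closed_fincodim_subspace X Y}. SUP y\<in>unit_sphere X \<inter> Y.
      ereal (vnorm X (x' \<oplus> of_real t \<odot> y) - 1)) \<le> asymptotic_smoothness X t"
    unfolding asymptotic_smoothness_def by (rule SUP_upper[OF x'S])
  also have "\<dots> \<le> ereal (C * t powr p)" using C t by blast
  \<comment> \<open>The infimum over subspaces need not be attained; the strict inequality gained
    from C + 1 yields an actual Y.\<close>
  also have "\<dots> < ereal ((C + 1) * t powr p)" using t by simp
  finally obtain Y where Y: "closed_fincodim_subspace X Y"
    and YS: "(SUP y\<in>unit_sphere X \<inter> Y. ereal (vnorm X (x' \<oplus> of_real t \<odot> y) - 1)) < ereal ((C + 1) * t powr p)"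
    by (auto simp: INF_less_iff)
  have YV: "vsubspace X Y" using Y by (simp add: closed_fincodim_iff)
  have unit: "vnorm X (of_real v \<odot> x' \<oplus> of_real s \<odot> y) \<le> P" if "y \<in> Y" "vnorm X y = 1" for y
  proof -
    have y [simp]: "y \<in> vecs X" using that YV subspaceD by blast
    have "ereal (vnorm X (x' \<oplus> of_real t \<odot> y) - 1) < ereal ((C + 1) * t powr p)"
      using that by (intro le_less_trans[OF SUP_upper YS]) (auto simp: unit_sphere_def)
    then have *: "vnorm X (x' \<oplus> of_real t \<odot> y) \<le> 1 + (C + 1) * t powr p" by simp
    have "of_real v * of_real t = (of_real s :: 'k)"
      using v0 by (simp add: t_def del: of_real_divide flip: of_real_mult)
    then have "of_real v \<odot> x' \<oplus> of_real s \<odot> y = of_real v \<odot> (x' \<oplus> of_real t \<odot> y)"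
      by (simp add: scale_add)
    then have "vnorm X (of_real v \<odot> x' \<oplus> of_real s \<odot> y) = v * vnorm X (x' \<oplus> of_real t \<odot> y)"
      using v0 by simp
    also have "\<dots> \<le> P" unfolding P_def using * v0 by (intro mult_left_mono) auto
    finally show ?thesis .
  qed
  have vP: "v \<le> P"
  proof -
    have "v * 1 \<le> P" unfolding P_def using v0 C by (intro mult_left_mono) auto
    then show ?thesis by simp
  qed
  show thesis
  proof (rule that[OF Y])
    fix y assume yY: "y \<in> Y" and ys: "vnorm X y \<le> s"
    have y [simp]: "y \<in> vecs X" using yY YV subspaceD by blast
    have "vnorm X (x \<oplus> y) \<le> P"
    proof (cases "y = vzero X")
      case True
      then show ?thesis using v vP by simp
    next
      case False
      then have ny: "0 < vnorm X y" by (metis less_eq_real_def norm_eq_0_iff norm_nonneg y)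
      define y' where "y' = of_real (1 / vnorm X y) \<odot> y"
      have y' [simp]: "y' \<in> vecs X" by (simp add: y'_def)
      have y'1: "vnorm X y' = 1" using ny by (auto simp: y'_def norm_divide)
      have "y' \<in> Y" using subspaceD(4)[OF YV yY] by (simp add: y'_def)
      note u = unit[OF this y'1]
      \<comment> \<open>Now x = a v x' and y = b s y' with a, b in [0, 1]. The smaller of a and b
        multiplies the full sum z, the rest points along x' or y', where the size is at most v or s,
        hence at most P. The total is at most max(a, b) P.\<close>
      define a where "a = vnorm X x / v"
      define b where "b = vnorm X y / s"
      have a: "0 \<le> a" "a \<le> 1" and b: "0 \<le> b" "b \<le> 1"
        using v ys v0 s nx ny by (auto simp: a_def b_def)
      have xa: "x = of_real (a * v) \<odot> x'" using nx v0 by (simp add: a_def x'_def flip: of_real_mult)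
      have yb: "y = of_real (b * s) \<odot> y'" using ny s by (simp add: b_def y'_def flip: of_real_mult)
      define z where "z = of_real v \<odot> x' \<oplus> of_real s \<odot> y'"
      have z [simp]: "z \<in> vecs X" by (simp add: z_def)
      consider "b \<le> a" | "a \<le> b" by linarith
      then show ?thesis
      proof cases
        case 1
        have "x \<oplus> y = of_real b \<odot> z \<oplus> of_real ((a - b) * v) \<odot> x'"
        proof -
          have "x = of_real (b * v) \<odot> x' \<oplus> of_real ((a - b) * v) \<odot> x'"
            unfolding xa by (simp add: algebra_simps flip: add_scale of_real_add)
          then have "x \<oplus> y = (of_real (b * v) \<odot> x' \<oplus> of_real ((a - b) * v) \<odot> x') \<oplus> of_real (b * s) \<odot> y'"
            using yb by simp
          then show ?thesis by (simp add: z_def scale_add add_ac)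
        qed
        then have "vnorm X (x \<oplus> y) \<le> vnorm X (of_real b \<odot> z) + vnorm X (of_real ((a - b) * v) \<odot> x')"
          by (simp add: norm_triangle del: norm_scale)
        also have "\<dots> = b * vnorm X z + (a - b) * v"
          using 1 b v0 \<open>vnorm X x' = 1\<close> by (simp add: abs_mult del: of_real_mult of_real_diff)
        also have "\<dots> \<le> b * P + (a - b) * P"
          using 1 b u vP by (intro add_mono mult_left_mono) (auto simp: z_def)
        also have "\<dots> = a * P" by (simp add: algebra_simps)
        also have "\<dots> \<le> P" using a vP v0 by (simp add: mult_left_le_one_le)
        finally show ?thesis .
      next
        case 2
        have "x \<oplus> y = of_real a \<odot> z \<oplus> of_real ((b - a) * s) \<odot> y'"
        proof -
          have "y = of_real (a * s) \<odot> y' \<oplus> of_real ((b - a) * s) \<odot> y'"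
            unfolding yb by (simp add: algebra_simps flip: add_scale of_real_add)
          then have "x \<oplus> y = of_real (a * v) \<odot> x' \<oplus> (of_real (a * s) \<odot> y' \<oplus> of_real ((b - a) * s) \<odot> y')"
            using xa by simp
          then show ?thesis by (simp add: z_def scale_add add_ac)
        qed
        then have "vnorm X (x \<oplus> y) \<le> vnorm X (of_real a \<odot> z) + vnorm X (of_real ((b - a) * s) \<odot> y')"
          by (simp add: norm_triangle del: norm_scale)
        also have "\<dots> = a * vnorm X z + (b - a) * s"
          using 2 a s y'1 by (simp add: abs_mult del: of_real_mult of_real_diff)
        also have "\<dots> \<le> a * P + (b - a) * P"
          using 2 a u vP s by (intro add_mono mult_left_mono) (auto simp: z_def)
        also have "\<dots> = b * P" by (simp add: algebra_simps)
        also have "\<dots> \<le> P" using b vP v0 by (simp add: mult_left_le_one_le)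
        finally show ?thesis .
      qed
    qed
    then show "vnorm X (x \<oplus> y) \<le> v * (1 + (C + 1) * (s / v) powr p)" by (simp add: P_def t_def)
  qed
qed

lemma essential_inradius_ge:
  assumes "0 < r" "x \<in> A" "closed_fincodim_subspace X Y" "\<not> finite_dim X"
    and "(\<lambda>y. x \<oplus> of_real r \<odot> y) ` (unit_ball X \<inter> Y) \<subseteq> A"
  shows "ennreal r \<le> essential_inradius X A"
  unfolding essential_inradius_def
  using assms not_finite_dim_closed_fincodim by (intro Sup_upper CollectI exI[of _ r]) blast

end

text \<open>The chord of the p-th power over [1, 1 + c] at weight q. It turns the multiplicative
  gain of a smoothness step into an additive one for p-th powers.\<close>

lemma powr_affine_bound:
  fixes c q p :: real
  assumes "1 < p" "0 \<le> c" "0 \<le> q" "q \<le> 1"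
  shows "(1 + c * q) powr p \<le> 1 + q * ((1 + c) powr p - 1)"
proof -
  have "((1 - q) *\<^sub>R 1 + q *\<^sub>R (1 + c)) powr p \<le> (1 - q) * 1 powr p + q * (1 + c) powr p"
    using powr_convex[of p] assms by (intro convex_onD) auto
  then show ?thesis by (simp add: algebra_simps)
qed

section \<open>Escaping from the covering sets\<close>

context euclidean_normed_structure
begin

text \<open>The ball of radius r about x in \<open>Y \<inter> Z\<close> is not contained in A k,
  which gives y; separating x + y from A k gives H. With Z' the intersection of Z and H, the sets of
  I stay avoided because y + z remains in Z.\<close>

lemma escape_step:
  assumes A: "\<And>k. k \<in> K \<Longrightarrow> A k \<subseteq> vecs X \<and> norm_closed X (A k) \<and> vconvex X (A k)"
    and inf: "\<not> finite_dim X" and r: "0 < r"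
    and small: "\<And>k. k \<in> K \<Longrightarrow> \<not> ennreal r \<le> essential_inradius X (A k)"
    and k: "k \<in> K" "x \<in> A k"
    and Z: "closed_fincodim_subspace X Z" "\<And>i z. i \<in> I \<Longrightarrow> z \<in> Z \<Longrightarrow> x \<oplus> z \<notin> A i"
    and Y: "closed_fincodim_subspace X Y"
  obtains y Z' where "y \<in> Y" "vnorm X y \<le> r" "closed_fincodim_subspace X Z'"
    "\<And>i z. i \<in> insert k I \<Longrightarrow> z \<in> Z' \<Longrightarrow> (x \<oplus> y) \<oplus> z \<notin> A i"
proof -
  have xV [simp]: "x \<in> vecs X" using A k by blast
  have YZ: "closed_fincodim_subspace X (Y \<inter> Z)" using Y Z by (rule_tac closed_fincodim_Int)
  have "\<not> (\<lambda>y. x \<oplus> of_real r \<odot> y) ` (unit_ball X \<inter> (Y \<inter> Z)) \<subseteq> A k"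
    using essential_inradius_ge[OF r k(2) YZ inf] small k by blast
  then obtain w where w: "w \<in> unit_ball X" "w \<in> Y" "w \<in> Z" "x \<oplus> of_real r \<odot> w \<notin> A k" by blast
  define y where "y = of_real r \<odot> w"
  have wV [simp]: "w \<in> vecs X" using w by (simp add: unit_ball_def)
  have yV [simp]: "y \<in> vecs X" by (simp add: y_def)
  have sub: "vsubspace X Y" "vsubspace X Z" using Y Z by (auto simp: closed_fincodim_iff)
  have y: "y \<in> Y" "y \<in> Z" using w subspaceD(4)[OF sub(1)] subspaceD(4)[OF sub(2)] by (auto simp: y_def)
  have yr: "vnorm X y \<le> r" using w r by (simp add: y_def unit_ball_def mult_left_le)
  obtain H where H: "closed_fincodim_subspace X H" "\<And>h. h \<in> H \<Longrightarrow> (x \<oplus> y) \<oplus> h \<notin> A k"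
    using separation[of "A k" "x \<oplus> y"] A k w by (auto simp: y_def)
  show thesis
  proof (rule that)
    show "closed_fincodim_subspace X (Z \<inter> H)" using Z H by (intro closed_fincodim_Int)
    fix i z assume i: "i \<in> insert k I" and z: "z \<in> Z \<inter> H"
    have zV: "z \<in> vecs X" using z subspaceD(5)[OF sub(2)] by blast
    have "x \<oplus> (y \<oplus> z) \<notin> A i" if "i \<in> I"
      using Z(2)[OF that] y z subspaceD(3)[OF sub(2)] by blast
    then show "(x \<oplus> y) \<oplus> z \<notin> A i" using i z H(2)[of z] zV by (cases "i \<in> I") (auto simp: add_assoc)
  qed (use y yr in auto)
qed

theorem covering_index_lower:
  assumes p: "1 < p" and inf: "\<not> finite_dim X" and AUS: "AUS_renormable p X"
  shows "\<exists>c>0. \<forall>n\<ge>1. ennreal (c * real n powr (- 1 / p)) \<le> covering_index X n"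
proof -
  obtain N a b C where N: "is_norm X N" and a: "0 < a" "\<And>x. x \<in> vecs X \<Longrightarrow> a * vnorm X x \<le> N x"
    and b: "0 < b" "\<And>x. x \<in> vecs X \<Longrightarrow> N x \<le> b * vnorm X x"
    and C: "0 < C" "\<And>t. 0 < t \<Longrightarrow> asymptotic_smoothness (X\<lparr>vnorm := N\<rparr>) t \<le> ereal (C * t powr p)"
    using AUS unfolding AUS_renormable_def equivalent_norm_def AUS_norm_def by blast
  interpret N: normed_structure "X\<lparr>vnorm := N\<rparr>" using normed_structure_renorm[OF N] .
  \<comment> \<open>Chosen so that b c (2 + C) = a, the exact constant needed for
    \<open>v n \<le> a\<close>.\<close>
  define c where "c = a / (b * (2 + C))"
  have c: "0 < c" using a b C by (simp add: c_def)
  have "ennreal (c * real n powr (- 1 / p)) \<le> covering_index X n" if n: "1 \<le> n" for n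
    unfolding covering_index_def
  proof (rule Inf_greatest, clarify)
    fix A assume A: "\<forall>k\<in>{1..n}. A k \<in> closed_convex_bounded X"
      and cover: "unit_ball X = (\<Union>k\<in>{1..n}. A k)"
    define r where "r = c * real n powr (- 1 / p)"
    have r: "0 < r" using c n by (simp add: r_def)
    have Ak: "A k \<subseteq> vecs X \<and> norm_closed X (A k) \<and> vconvex X (A k)" if "k \<in> {1..n}" for k
      using A that by (auto simp: closed_convex_bounded_def)
    define s where "s = b * r"
    have s: "0 < s" using b r by (simp add: s_def)
    \<comment> \<open>The chord increment (1 + c) powr p - 1 of \<open>powr_affine_bound\<close>,
      with C + 1 in the place of c.\<close>
    define D where "D = (2 + C) powr p - 1"
    have D: "0 \<le> D" using C p by (simp add: D_def ge_one_powr_ge_zero)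
    \<comment> \<open>Bound for N after j increments: its p-th power starts at that of s and grows
      by D s powr p per step. Starting at s although the first point is 0 ensures s <= v j, as
      \<open>AUS_step\<close> demands.\<close>
    define v where "v j = s * (1 + real j * D) powr (1 / p)" for j
    have vs: "s \<le> v j" for j
      using s D p by (auto simp: v_def intro!: ge_one_powr_ge_zero mult_left_le[THEN order_trans, rotated])
    have v0: "0 < v j" for j using vs[of j] s by simp
    have v_pow: "v j powr p = s powr p * (1 + real j * D)" for j
      using s D p by (simp add: v_def powr_mult powr_powr)
    have v_step: "v j * (1 + (C + 1) * (s / v j) powr p) \<le> v (Suc j)" for j
    proof -
      define q where "q = (s / v j) powr p"
      have q: "0 \<le> q" "q \<le> 1" using s vs[of j] p v0[of j] by (auto simp: q_def powr_le1)
      have qv: "q * v j powr p = s powr p" using s v0[of j] by (simp add: q_def powr_divide)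
      have "(v j * (1 + (C + 1) * q)) powr p = v j powr p * (1 + (C + 1) * q) powr p"
        using v0[of j] q C by (simp add: powr_mult)
      also have "\<dots> \<le> v j powr p * (1 + q * D)"
        using powr_affine_bound[of p "C + 1" q] p C q by (intro mult_left_mono) (auto simp: D_def)
      also have "\<dots> = v j powr p + D * (q * v j powr p)" by (simp add: algebra_simps)
      also have "\<dots> = v j powr p + D * s powr p" by (simp only: qv)
      also have "\<dots> = v (Suc j) powr p" unfolding v_pow by (simp add: algebra_simps)
      finally have "(v j * (1 + (C + 1) * q)) powr p \<le> v (Suc j) powr p" .
      then show ?thesis
        using powr_less_mono2[of p "v (Suc j)" "v j * (1 + (C + 1) * q)"] p v0[of "Suc j"]
        unfolding q_def by linarith
    qed
    have v_mono: "v j \<le> v n" if "j \<le> n" for j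
      unfolding v_def using that s D p by (intro mult_left_mono powr_mono2 add_mono mult_right_mono) auto
    \<comment> \<open>Uses 1 + n D <= n (1 + D) for n >= 1, and that the p-th root of 1 + D is 2 +
      C.\<close>
    have "v n \<le> a"
    proof -
      have "v n \<le> s * (real n * (1 + D)) powr (1 / p)"
        unfolding v_def using s D p n by (intro mult_left_mono powr_mono2) (auto simp: algebra_simps)
      also have "\<dots> = s * (real n powr (1 / p) * (2 + C))"
        using p C by (simp add: D_def powr_mult powr_powr)
      also have "\<dots> = a * (real n powr (- 1 / p) * real n powr (1 / p))"
        using b C by (simp add: s_def r_def c_def)
      also have "\<dots> = a" using n by (simp flip: powr_add)
      finally show ?thesis .
    qed
    have "\<not> (\<forall>k\<in>{1..n}. \<not> ennreal r \<le> essential_inradius X (A k))"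
    proof
      assume small: "\<forall>k\<in>{1..n}. \<not> ennreal r \<le> essential_inradius X (A k)"
      have ball: "x \<in> unit_ball X" if "x \<in> vecs X" "N x \<le> a" for x
      proof -
        have "a * vnorm X x \<le> a * 1" using a(2)[OF that(1)] that(2) by simp
        then have "vnorm X x \<le> 1" using a(1) by (metis mult_le_cancel_left_pos)
        then show ?thesis using that by (simp add: unit_ball_def)
      qed
      \<comment> \<open>Invariant: I holds the indices of j sets already left for good, in the sense
        that the whole coset x + Z misses them.\<close>
      have "\<exists>x Z I. x \<in> vecs X \<and> N x \<le> v j \<and> closed_fincodim_subspace X Z \<and> I \<subseteq> {1..n} \<and>
          card I = j \<and> (\<forall>i\<in>I. \<forall>z\<in>Z. x \<oplus> z \<notin> A i)" if "j \<le> n" for j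
        using that
      proof (induction j)
        case 0
        have "N (vzero X) = 0" using N by (simp add: is_norm_def)
        then show ?case using v0[of 0]
          by (intro exI[of _ "vzero X"] exI[of _ "vecs X"] exI[of _ "{}"]) auto
      next
        case (Suc j)
        then obtain x Z I where x: "x \<in> vecs X" "N x \<le> v j" and Z: "closed_fincodim_subspace X Z"
          and I: "I \<subseteq> {1..n}" "card I = j" and out: "\<And>i z. i \<in> I \<Longrightarrow> z \<in> Z \<Longrightarrow> x \<oplus> z \<notin> A i"
          by auto
        have "N x \<le> a" using x(2) v_mono[of j] \<open>v n \<le> a\<close> Suc.prems by simp
        then obtain k where k: "k \<in> {1..n}" "x \<in> A k" using ball[OF x(1)] cover by blast
        \<comment> \<open>Since 0 lies in Z, the point x itself is in none of the sets of I; so the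
          index k of a set containing x is new.\<close>
        have "vzero X \<in> Z" using Z subspaceD(2) by (auto simp: closed_fincodim_iff)
        then have "k \<notin> I" using out[of k "vzero X"] k x(1) by auto
        obtain Y where Y: "closed_fincodim_subspace (X\<lparr>vnorm := N\<rparr>) Y"
          "\<And>y. y \<in> Y \<Longrightarrow> N y \<le> s \<Longrightarrow> N (x \<oplus> y) \<le> v j * (1 + (C + 1) * (s / v j) powr p)"
          using N.AUS_step[OF C, of x "v j" s] x s vs by auto
        have YX: "closed_fincodim_subspace X Y" by (rule closed_fincodim_renorm[OF N b Y(1)])
        obtain y Z' where y: "y \<in> Y" "vnorm X y \<le> r" and Z': "closed_fincodim_subspace X Z'"
          and out': "\<And>i z. i \<in> insert k I \<Longrightarrow> z \<in> Z' \<Longrightarrow> (x \<oplus> y) \<oplus> z \<notin> A i"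
          using escape_step[where A = A and K = "{1..n}", OF Ak inf r small[rule_format] k Z out YX]
          by blast
        have yV: "y \<in> vecs X" using y(1) YX subspaceD(5) by (auto simp: closed_fincodim_iff)
        have "N y \<le> s" using order_trans[OF b(2)[OF yV] mult_left_mono[OF y(2)]] b(1) by (simp add: s_def)
        then have "N (x \<oplus> y) \<le> v (Suc j)" using Y(2)[OF y(1)] v_step[of j] by simp
        moreover have "card (insert k I) = Suc j"
          using I \<open>k \<notin> I\<close> finite_subset[OF I(1)] by simp
        ultimately show ?case
          using x yV Z' out' I k by (intro exI[of _ "x \<oplus> y"] exI[of _ Z'] exI[of _ "insert k I"]) auto
      qed
      then obtain x Z I where x: "x \<in> vecs X" "N x \<le> v n" and Z: "closed_fincodim_subspace X Z"
        and I: "I \<subseteq> {1..n}" "card I = n" and out: "\<And>i z. i \<in> I \<Longrightarrow> z \<in> Z \<Longrightarrow> x \<oplus> z \<notin> A i"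
        by blast
      \<comment> \<open>After n steps all sets are avoided by x, which still lies in the unit
        ball.\<close>
      have "I = {1..n}" using I by (intro card_subset_eq) auto
      moreover have "x \<in> unit_ball X" using ball x \<open>v n \<le> a\<close> by simp
      moreover have "vzero X \<in> Z" using Z subspaceD(2) by (auto simp: closed_fincodim_iff)
      ultimately show False using cover out[of _ "vzero X"] x(1) by auto
    qed
    then obtain k where "k \<in> {1..n}" "ennreal r \<le> essential_inradius X (A k)" by blast
    then show "ennreal r \<le> Max ((\<lambda>k. essential_inradius X (A k)) ` {1..n})"
      by (intro order_trans[OF _ Max_ge]) auto
  qed
  then show ?thesis using c by blast
qed

end

subsection \<open>Projections and the essential inradius\<close>

context vector_structure
begin

text \<open>Take f in \<open>Z \<inter> U m\<close>, an m' with f outside U m', and g in Z and in U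
  (max m m'). If neither f nor g lies in Y, the combination of f and g that cancels b does. It is
  nonzero, for otherwise f would be a multiple of g and belong to U m'.\<close>

lemma codim1_tail:
  assumes U: "\<And>m. vsubspace V (U m)" "decseq U" "\<And>f. f \<in> vecs V \<Longrightarrow> (\<And>m. f \<in> U m) \<Longrightarrow> f = vzero V"
    and ZY: "codim1 Z Y" and Z: "\<And>m. \<exists>f\<in>Z \<inter> U m. f \<noteq> vzero V"
  shows "\<exists>f\<in>Y \<inter> U m. f \<noteq> vzero V"
proof -
  obtain b where sub: "vsubspace V Z" "vsubspace V Y" "b \<in> Z"
    and b: "\<And>z. z \<in> Z \<Longrightarrow> \<exists>c. z \<ominus> c \<odot> b \<in> Y"
    using ZY by (auto simp: codim1_def)
  note ZV = subspaceD(5)[OF sub(1)]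
  obtain f where f: "f \<in> Z" "f \<in> U m" "f \<noteq> vzero V" using Z[of m] by auto
  obtain m' where m': "f \<notin> U m'" using U(3)[of f] f ZV by blast
  obtain g where g: "g \<in> Z" "g \<in> U (max m m')" "g \<noteq> vzero V" using Z by blast
  have gU: "g \<in> U m" "g \<in> U m'"
    using g(2) decseqD[OF U(2), of m "max m m'"] decseqD[OF U(2), of m' "max m m'"] by auto
  have [simp]: "f \<in> vecs V" "g \<in> vecs V" "b \<in> vecs V" using f g sub ZV by auto
  obtain c d where c: "f \<ominus> c \<odot> b \<in> Y" and d: "g \<ominus> d \<odot> b \<in> Y" using b f g by metis
  show ?thesis
  proof (cases "c = 0 \<or> d = 0")
    case True
    then have "f \<in> Y \<or> g \<in> Y" using c d by auto
    then show ?thesis using f g gU by blast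
  next
    case False
    define l where "l = d / c"
    have l: "l \<noteq> 0" "l * c = d" using False by (auto simp: l_def)
    have "(g \<ominus> d \<odot> b) \<oplus> (- l) \<odot> (f \<ominus> c \<odot> b) \<in> Y"
      using c d subspaceD(3,4)[OF sub(2)] by meson
    also have "(g \<ominus> d \<odot> b) \<oplus> (- l) \<odot> (f \<ominus> c \<odot> b) = g \<oplus> (- l) \<odot> f"
      using l(2) by (simp add: scale_add add_ac)
    finally have Y: "g \<oplus> (- l) \<odot> f \<in> Y" .
    moreover have "g \<oplus> (- l) \<odot> f \<in> U m" using f gU subspaceD(3,4)[OF U(1)] by meson
    moreover have "g \<oplus> (- l) \<odot> f \<noteq> vzero V"
    proof
      assume "g \<oplus> (- l) \<odot> f = vzero V"
      then have "g \<oplus> (- l) \<odot> f = l \<odot> f \<oplus> (- l) \<odot> f" by simp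
      then have "g = l \<odot> f"
        using add_cancel[of "(- l) \<odot> f" g "l \<odot> f"] by (simp add: add_commute)
      then have "f = (1 / l) \<odot> g" using l by simp
      then show False using m' gU(2) subspaceD(4)[OF U(1)] by metis
    qed
    ultimately show ?thesis by blast
  qed
qed

text \<open>The sequence \<open>U\<close> witnesses that \<open>Z\<close> is infinite-dimensional.\<close>

lemma fincodim_tail:
  assumes U: "\<And>m. vsubspace V (U m)" "decseq U" "\<And>f. f \<in> vecs V \<Longrightarrow> (\<And>m. f \<in> U m) \<Longrightarrow> f = vzero V"
    and ZY: "fincodim Z Y" and Z: "\<And>m. \<exists>f\<in>Z \<inter> U m. f \<noteq> vzero V"
  shows "\<exists>f\<in>Y \<inter> U m. f \<noteq> vzero V"
  using ZY
proof (induction arbitrary: m rule: rtranclp_induct)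
  case base
  show ?case by (rule Z)
next
  case (step Y Y')
  show ?case by (rule codim1_tail[OF U step(2) step(3)])
qed

end

text \<open>Abstracts the restriction of functions to a measurable set; the fixed vectors are then
  the functions supported there.\<close>

locale projection_structure = normed_structure X
  for X :: "('k::real_normed_field, 'v, 'z) nspace_scheme" +
  fixes P :: "'v \<Rightarrow> 'v"
  assumes P_closed [simp]: "x \<in> vecs X \<Longrightarrow> P x \<in> vecs X"
    and P_add: "x \<in> vecs X \<Longrightarrow> y \<in> vecs X \<Longrightarrow> P (vadd X x y) = vadd X (P x) (P y)"
    and P_scale: "x \<in> vecs X \<Longrightarrow> P (vscale X c x) = vscale X c (P x)"
    and P_norm: "x \<in> vecs X \<Longrightarrow> vnorm X (P x) \<le> vnorm X x"
begin

definition fixed_vecs :: "'v set" where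
  "fixed_vecs = {x \<in> vecs X. P x = x}"

definition slab :: "real \<Rightarrow> 'v set" where
  "slab s = {x \<in> unit_ball X. vnorm X (P x) \<le> s}"

lemma subspace_fixed_vecs: "vsubspace X fixed_vecs"
proof -
  have "P (vzero X) = vzero X" using P_scale[of "vzero X" 0] by simp
  then show ?thesis by (auto simp: vsubspace_def fixed_vecs_def P_add P_scale)
qed

lemma P_sub: "x \<in> vecs X \<Longrightarrow> y \<in> vecs X \<Longrightarrow> P (x \<ominus> y) = P x \<ominus> P y"
  by (simp add: P_add P_scale)

lemma slab_closed_convex_bounded: "slab s \<in> closed_convex_bounded X"
proof -
  have "norm_closed X (slab s)"
    unfolding norm_closed_iff
  proof (intro conjI ballI)
    show "slab s \<subseteq> vecs X" by (auto simp: slab_def unit_ball_def)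
    fix x assume "x \<in> vecs X - slab s"
    then have x: "x \<in> vecs X" and "1 < vnorm X x \<or> s < vnorm X (P x)"
      by (auto simp: slab_def unit_ball_def)
    \<comment> \<open>The larger of the two excesses bounds the distance to the slab, because both
      the norm and the norm of the image under P change by at most the distance.\<close>
    then have e: "0 < max (vnorm X x - 1) (vnorm X (P x) - s)" (is "0 < ?e") by auto
    have "?e \<le> vnorm X (a \<ominus> x)" if "a \<in> slab s" for a
    proof -
      have a: "a \<in> vecs X" "vnorm X a \<le> 1" "vnorm X (P a) \<le> s"
        using that by (auto simp: slab_def unit_ball_def)
      have tri: "vnorm X y \<le> vnorm X (b \<ominus> y) + vnorm X b" if "y \<in> vecs X" "b \<in> vecs X" for y b
      proof -
        have "vnorm X y = vnorm X (b \<oplus> (y \<ominus> b))" using that by simp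
        also have "\<dots> \<le> vnorm X b + vnorm X (y \<ominus> b)" using that by (intro norm_triangle) auto
        finally show ?thesis using norm_sub_commute[of y b] that by simp
      qed
      have "vnorm X (P a \<ominus> P x) \<le> vnorm X (a \<ominus> x)"
        using P_norm[of "a \<ominus> x"] P_sub[of a x] a x by simp
      then show ?thesis using tri[OF x a(1)] tri[of "P x" "P a"] a x by simp
    qed
    then show "\<exists>r>0. \<forall>a\<in>slab s. r \<le> vnorm X (a \<ominus> x)" using e by blast
  qed
  moreover have "vconvex X (slab s)"
    unfolding vconvex_def
  proof (intro ballI allI impI)
    fix x y and t :: real assume "x \<in> slab s" "y \<in> slab s" and t: "0 \<le> t \<and> t \<le> 1"
    then have xy: "x \<in> vecs X" "vnorm X x \<le> 1" "vnorm X (P x) \<le> s"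
      "y \<in> vecs X" "vnorm X y \<le> 1" "vnorm X (P y) \<le> s" by (auto simp: slab_def unit_ball_def)
    have conv: "vnorm X (of_real (1 - t) \<odot> v \<oplus> of_real t \<odot> w) \<le> r"
      if "v \<in> vecs X" "w \<in> vecs X" "vnorm X v \<le> r" "vnorm X w \<le> r" for v w r
    proof -
      have "vnorm X (of_real (1 - t) \<odot> v \<oplus> of_real t \<odot> w) \<le> (1 - t) * vnorm X v + t * vnorm X w"
        using norm_triangle[of "of_real (1 - t) \<odot> v" "of_real t \<odot> w"] that t
        by (simp del: of_real_diff)
      also have "\<dots> \<le> (1 - t) * r + t * r" using that t by (intro add_mono mult_left_mono) auto
      finally show ?thesis by (simp add: algebra_simps)
    qed
    show "of_real (1 - t) \<odot> x \<oplus> of_real t \<odot> y \<in> slab s"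
      using conv[of x y 1] conv[of "P x" "P y" s] xy by (simp add: slab_def unit_ball_def P_add P_scale)
  qed
  ultimately show ?thesis
    by (auto simp: closed_convex_bounded_def norm_bounded_def slab_def unit_ball_def)
qed

text \<open>For a unit vector w in Y fixed by P, both x + r w and x - r w lie in the slab. The
  difference of their images is 2 r w, so 2 r <= 2 s by the triangle inequality.\<close>

lemma essential_inradius_slab_le:
  assumes W: "\<And>Y. closed_fincodim_subspace X Y \<Longrightarrow> \<exists>w\<in>fixed_vecs \<inter> Y. w \<noteq> vzero X"
  shows "essential_inradius X (slab s) \<le> ennreal s"
  unfolding essential_inradius_def
proof (rule Sup_least, clarify)
  fix r x Y assume r: "0 < r" and x: "x \<in> slab s" and Y: "closed_fincodim_subspace X Y"
    and sub: "(\<lambda>y. x \<oplus> of_real r \<odot> y) ` (unit_ball X \<inter> Y) \<subseteq> slab s"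
  have xV [simp]: "x \<in> vecs X" using x by (simp add: slab_def unit_ball_def)
  have YV: "vsubspace X Y" using Y by (simp add: closed_fincodim_iff)
  obtain w0 where w0: "w0 \<in> fixed_vecs" "w0 \<in> Y" "w0 \<noteq> vzero X" using W[OF Y] by auto
  have w0V [simp]: "w0 \<in> vecs X" using w0 by (simp add: fixed_vecs_def)
  have n0: "0 < vnorm X w0" using w0 by (metis less_eq_real_def norm_eq_0_iff norm_nonneg w0V)
  define w where "w = of_real (1 / vnorm X w0) \<odot> w0"
  have w: "w \<in> fixed_vecs" "w \<in> Y" "w \<in> vecs X" "P w = w"
    using w0 subspaceD(4)[OF YV] subspaceD(4)[OF subspace_fixed_vecs]
    by (auto simp: w_def fixed_vecs_def P_scale)
  have w1: "vnorm X w = 1" using n0 w0 by (auto simp: w_def norm_divide)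
  have mw: "(- 1) \<odot> w \<in> Y" "w \<in> unit_ball X" "(- 1) \<odot> w \<in> unit_ball X"
    using w w1 subspaceD(4)[OF YV] by (auto simp: unit_ball_def)
  have "x \<oplus> of_real r \<odot> w \<in> slab s" "x \<oplus> of_real r \<odot> (- 1) \<odot> w \<in> slab s"
    using sub w mw by blast+
  then have n: "vnorm X (P (x \<oplus> of_real r \<odot> w)) \<le> s" "vnorm X (P (x \<oplus> (- of_real r) \<odot> w)) \<le> s"
    using w by (auto simp: slab_def)
  have "P (x \<oplus> of_real r \<odot> w) \<ominus> P (x \<oplus> (- of_real r) \<odot> w) = of_real (2 * r) \<odot> w"
  proof -
    have "P (x \<oplus> of_real r \<odot> w) \<ominus> P (x \<oplus> (- of_real r) \<odot> w) =
        (P x \<oplus> of_real r \<odot> w) \<oplus> ((- 1) \<odot> P x \<oplus> of_real r \<odot> w)"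
      using w by (simp add: P_add P_scale scale_add)
    also have "\<dots> = of_real r \<odot> w \<oplus> of_real r \<odot> w" using w by (simp add: add_ac)
    also have "\<dots> = of_real (2 * r) \<odot> w" by (metis add_scale mult_2 of_real_add w(3))
    finally show ?thesis .
  qed
  then have "2 * r = vnorm X (P (x \<oplus> of_real r \<odot> w) \<ominus> P (x \<oplus> (- of_real r) \<odot> w))"
    using w w1 r by (simp add: abs_mult norm_mult)
  also have "\<dots> \<le> vnorm X (P (x \<oplus> of_real r \<odot> w)) + vnorm X ((- 1) \<odot> P (x \<oplus> (- of_real r) \<odot> w))"
    using w by (intro norm_triangle) auto
  also have "vnorm X ((- 1) \<odot> P (x \<oplus> (- of_real r) \<odot> w)) = vnorm X (P (x \<oplus> (- of_real r) \<odot> w))"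
    using w by (subst norm_scale) auto
  finally show "ennreal r \<le> ennreal s" using n by (intro ennreal_leI) simp
qed

end

subsection \<open>\<open>L\<^sub>p(\<mu>)\<close> as a normed space\<close>

text \<open>Convexity on the positive reals, extended to endpoints equal to 0 by s powr p <= s for s
  in [0, 1].\<close>

lemma powr_convex_nonneg:
  fixes p t x y :: real
  assumes "1 \<le> p" "0 \<le> t" "t \<le> 1" "0 \<le> x" "0 \<le> y"
  shows "((1 - t) * x + t * y) powr p \<le> (1 - t) * x powr p + t * y powr p"
proof -
  have le: "(s * z) powr p \<le> s * z powr p" if "0 \<le> s" "s \<le> 1" "0 \<le> z" for s z :: real
  proof -
    have "s powr p \<le> s powr 1" using that assms by (intro powr_mono') auto
    then show ?thesis using that by (simp add: powr_mult mult_right_mono)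
  qed
  consider "x = 0" | "y = 0" | "0 < x" "0 < y" using assms by linarith
  then show ?thesis
  proof cases
    case 3
    have "((1 - t) *\<^sub>R x + t *\<^sub>R y) powr p \<le> (1 - t) * x powr p + t * y powr p"
      using powr_convex[of p] assms 3 by (intro convex_onD) auto
    then show ?thesis by simp
  qed (use le[of t y] le[of "1 - t" x] assms in auto)
qed

text \<open>x + y is a + b times the convex combination of x / a and y / b with weights a / (a + b)
  and b / (a + b). Integrated with bounds for the two norms as a and b, this is Minkowski's
  inequality.\<close>

lemma powr_add_le:
  fixes a b p x y :: real
  assumes "1 \<le> p" "0 < a" "0 < b" "0 \<le> x" "0 \<le> y"
  shows "(x + y) powr p \<le> (a + b) powr p * (a / (a + b) * (x powr p / a powr p) + b / (a + b) * (y powr p / b powr p))"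
proof -
  define t where "t = b / (a + b)"
  have t: "0 \<le> t" "t \<le> 1" "1 - t = a / (a + b)" using assms by (auto simp: t_def field_simps)
  have "(1 - t) * (x / a) + t * (y / b) = x / (a + b) + y / (a + b)"
    using assms by (simp add: t(3)) (simp add: t_def)
  then have "x + y = (a + b) * ((1 - t) * (x / a) + t * (y / b))"
    unfolding add_divide_distrib[symmetric] using assms by simp
  then have "(x + y) powr p = (a + b) powr p * ((1 - t) * (x / a) + t * (y / b)) powr p"
    using assms t by (simp add: powr_mult)
  also have "\<dots> \<le> (a + b) powr p * ((1 - t) * (x / a) powr p + t * (y / b) powr p)"
    using assms t by (intro mult_left_mono powr_convex_nonneg) auto
  finally show ?thesis using assms by (simp add: t(3) powr_divide) (simp add: t_def)
qed

text \<open>The \<open>itself\<close> parameter fixes the scalar type, so that one development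
  serves real and complex spaces.\<close>

locale Lp_structure =
  fixes M :: "'a measure" and p :: real and T :: "'k::{real_normed_field,euclidean_space} itself"
  assumes p: "1 < p"
begin

abbreviation L :: "('k, 'a \<Rightarrow> 'k) vspace" where "L \<equiv> Lp_functions M p"
abbreviation null :: "('a \<Rightarrow> 'k) set" where "null \<equiv> null_functions M"
abbreviation X :: "('k, ('a \<Rightarrow> 'k) set) nspace" where "X \<equiv> Lp_space M p"

lemma L_simps [simp]:
  "vzero L = (\<lambda>x. 0)" "vadd L f g = (\<lambda>x. f x + g x)" "vscale L c f = (\<lambda>x. c * f x)"
  by (simp_all add: Lp_functions_def)

lemma L_iff: "f \<in> vecs L \<longleftrightarrow> f \<in> borel_measurable M \<and> integrable M (\<lambda>x. norm (f x) powr p)"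
  by (simp add: Lp_functions_def)

lemma LD [measurable_dest]: "f \<in> vecs L \<Longrightarrow> f \<in> borel_measurable M"
  by (simp add: L_iff)

lemma L_integrable: "f \<in> vecs L \<Longrightarrow> integrable M (\<lambda>x. norm (f x) powr p)"
  by (simp add: L_iff)

lemma L_dominated:
  assumes "g \<in> vecs L" "f \<in> borel_measurable M" "\<And>x. norm (f x) \<le> norm (g x)"
  shows "f \<in> vecs L"
proof -
  have "integrable M (\<lambda>x. norm (f x) powr p)"
    using L_integrable[OF assms(1)]
    by (rule Bochner_Integration.integrable_bound) (use assms p in \<open>auto intro!: AE_I2 powr_mono2\<close>)
  then show ?thesis using assms by (simp add: L_iff)
qed

lemma L_add:
  assumes "f \<in> vecs L" "g \<in> vecs L"
  shows "(\<lambda>x. f x + g x) \<in> vecs L"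
proof -
  note [measurable] = LD[OF assms(1)] LD[OF assms(2)]
  let ?h = "\<lambda>x. 2 powr p * (norm (f x) powr p + norm (g x) powr p)"
  have "integrable M ?h" using assms by (simp add: L_integrable)
  then have "integrable M (\<lambda>x. norm (f x + g x) powr p)"
  proof (rule Bochner_Integration.integrable_bound)
    have "norm (f x + g x) powr p \<le> ?h x" for x
    proof -
      have "norm (f x + g x) powr p \<le> (norm (f x) + norm (g x)) powr p"
        using p by (intro powr_mono2 norm_triangle_ineq) auto
      also have "\<dots> \<le> 2 powr p * (norm (f x) powr p / 2 + norm (g x) powr p / 2)"
        using powr_add_le[of p 1 1 "norm (f x)" "norm (g x)"] p by simp
      also have "\<dots> \<le> ?h x" by (intro mult_left_mono add_mono) auto
      finally show ?thesis .
    qed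
    then show "AE x in M. norm (norm (f x + g x) powr p) \<le> norm (?h x)" by auto
  qed measurable
  then show ?thesis by (simp add: L_iff)
qed

lemma L_scale: "f \<in> vecs L \<Longrightarrow> (\<lambda>x. c * f x) \<in> vecs L"
  using L_integrable by (auto simp: L_iff norm_mult powr_mult)

sublocale L: vector_structure L
proof unfold_locales
  show "vzero L \<in> vecs L" using p by (simp add: L_iff)
qed (auto simp: L_add L_scale algebra_simps)

lemma nullD: "f \<in> null \<longleftrightarrow> f \<in> borel_measurable M \<and> (AE x in M. f x = 0)"
  by (simp add: null_functions_def)

lemma null_L: "null \<subseteq> vecs L"
proof
  fix f assume f: "f \<in> null"
  then have [measurable]: "f \<in> borel_measurable M" by (simp add: nullD)
  have "integrable M (\<lambda>x. norm (f x) powr p) \<longleftrightarrow> integrable M (\<lambda>x. 0 :: real)"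
    by (rule integrable_cong_AE) (use f p in \<open>auto simp: nullD\<close>)
  then show "f \<in> vecs L" by (simp add: L_iff)
qed

lemma null_subspace: "vsubspace L null"
  using null_L unfolding vsubspace_def by (auto simp: nullD)

definition cl :: "('a \<Rightarrow> 'k) \<Rightarrow> ('a \<Rightarrow> 'k) set" where
  "cl = L.coset null"

section \<open>Classes modulo null functions, and their norm\<close>

lemma X_quotient:
  "vecs X = vecs (quotient_space L null)" "vzero X = vzero (quotient_space L null)"
  "vadd X = vadd (quotient_space L null)" "vscale X = vscale (quotient_space L null)"
  by (simp_all add: Lp_space_def vspace.defs)

lemma X_vecs: "vecs X = cl ` vecs L"
  and X_zero: "vzero X = cl (\<lambda>x. 0)"
  and X_add: "f \<in> vecs L \<Longrightarrow> g \<in> vecs L \<Longrightarrow> vadd X (cl f) (cl g) = cl (\<lambda>x. f x + g x)"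
  and X_scale: "f \<in> vecs L \<Longrightarrow> vscale X c (cl f) = cl (\<lambda>x. c * f x)"
  unfolding X_quotient cl_def
  by (simp_all only: L.quotient_vecs[OF null_subspace] L.quotient_zero[OF null_subspace]
      L.quotient_add[OF null_subspace] L.quotient_scale[OF null_subspace] L_simps)

lemma cl_cases:
  assumes "F \<in> vecs X"
  obtains f where "f \<in> vecs L" "F = cl f"
  using assms by (auto simp: X_vecs)

lemma cl_closed [simp]: "f \<in> vecs L \<Longrightarrow> cl f \<in> vecs X"
  by (auto simp: X_vecs)

lemma diff_null_iff:
  assumes "f \<in> vecs L" "g \<in> vecs L"
  shows "vadd L f (vscale L (- 1) g) \<in> null \<longleftrightarrow> (AE x in M. f x = g x)"
proof -
  note [measurable] = LD[OF assms(1)] LD[OF assms(2)]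
  have "vadd L f (vscale L (- 1) g) = (\<lambda>x. f x - g x)" by simp
  moreover have "(\<lambda>x. f x - g x) \<in> borel_measurable M" by measurable
  ultimately show ?thesis by (simp add: nullD)
qed

lemma in_cl_iff:
  assumes "f \<in> vecs L"
  shows "g \<in> cl f \<longleftrightarrow> g \<in> vecs L \<and> (AE x in M. g x = f x)"
  unfolding cl_def L.coset_eq[OF null_subspace assms] mem_Collect_eq
  using diff_null_iff assms by blast

lemma cl_eq_iff:
  assumes "f \<in> vecs L" "g \<in> vecs L"
  shows "cl f = cl g \<longleftrightarrow> (AE x in M. f x = g x)"
  unfolding cl_def L.coset_eq_iff[OF null_subspace assms] by (rule diff_null_iff[OF assms])

text \<open>Makes the choice of representative harmless, both in \<open>Lp_norm\<close> and in the
  restriction operator \<open>P\<close>.\<close>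

lemma cl_some:
  assumes "f \<in> vecs L"
  shows "(SOME g. g \<in> cl f) \<in> vecs L" "AE x in M. (SOME g. g \<in> cl f) x = f x"
  using someI[of "\<lambda>g. g \<in> cl f" f] assms by (simp_all add: in_cl_iff)

lemma X_norm:
  assumes f: "f \<in> vecs L"
  shows "vnorm X (cl f) = (\<integral>x. norm (f x) powr p \<partial>M) powr (1 / p)"
proof -
  note [measurable] = LD[OF f] LD[OF cl_some(1)[OF f]]
  have "(\<integral>x. norm ((SOME g. g \<in> cl f) x) powr p \<partial>M) = (\<integral>x. norm (f x) powr p \<partial>M)"
    using cl_some(2)[OF f] by (intro integral_cong_AE) auto
  then show ?thesis
    by (simp add: Lp_space_def vspace.defs nspace.defs Lp_norm_def)
qed

lemma X_norm_powr: "f \<in> vecs L \<Longrightarrow> vnorm X (cl f) powr p = (\<integral>x. norm (f x) powr p \<partial>M)"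
  using p by (simp add: X_norm powr_powr)

lemma X_norm_le_iff:
  assumes "f \<in> vecs L" "0 < a"
  shows "vnorm X (cl f) \<le> a \<longleftrightarrow> (\<integral>x. norm (f x) powr p \<partial>M) \<le> a powr p"
proof -
  have n: "0 \<le> vnorm X (cl f)" using assms by (simp add: X_norm)
  show ?thesis
    using powr_mono2[of p "vnorm X (cl f)" a] powr_less_mono2[of p a "vnorm X (cl f)"] p n assms
    by (auto simp: X_norm_powr[symmetric] not_le[symmetric])
qed

text \<open>Proved first for positive upper bounds a and b of the norms, which avoids dividing by a
  vanishing norm; then the bounds are lowered to the norms by an epsilon argument.\<close>

lemma minkowski:
  assumes f: "f \<in> vecs L" and g: "g \<in> vecs L"
  shows "vnorm X (cl (\<lambda>x. f x + g x)) \<le> vnorm X (cl f) + vnorm X (cl g)"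
proof -
  have le: "vnorm X (cl (\<lambda>x. f x + g x)) \<le> a + b"
    if a: "vnorm X (cl f) \<le> a" "0 < a" and b: "vnorm X (cl g) \<le> b" "0 < b" for a b
  proof -
    note [measurable] = LD[OF f] LD[OF g]
    let ?F = "\<integral>x. norm (f x) powr p \<partial>M" and ?G = "\<integral>x. norm (g x) powr p \<partial>M"
    have F: "?F \<le> a powr p" and G: "?G \<le> b powr p" using a b f g by (simp_all add: X_norm_le_iff)
    let ?h = "\<lambda>x. (a + b) powr p * (a / (a + b) * (norm (f x) powr p / a powr p) + b / (a + b) * (norm (g x) powr p / b powr p))"
    have int: "integrable M ?h" using f g by (simp add: L_integrable)
    have "(\<integral>x. norm (f x + g x) powr p \<partial>M) \<le> (\<integral>x. ?h x \<partial>M)"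
    proof (rule integral_mono[OF L_integrable[OF L_add[OF f g]] int])
      fix x
      have "norm (f x + g x) powr p \<le> (norm (f x) + norm (g x)) powr p"
        using p by (intro powr_mono2 norm_triangle_ineq) auto
      also have "\<dots> \<le> ?h x" using p a b by (intro powr_add_le) auto
      finally show "norm (f x + g x) powr p \<le> ?h x" .
    qed
    also have "\<dots> = (a + b) powr p * (a / (a + b) * (?F / a powr p) + b / (a + b) * (?G / b powr p))"
      using f g by (simp add: L_integrable)
    also have "\<dots> \<le> (a + b) powr p * (a / (a + b) * 1 + b / (a + b) * 1)"
      using F G a b by (intro mult_left_mono add_mono) auto
    also have "a / (a + b) * 1 + b / (a + b) * 1 = 1"
      unfolding mult_1_right add_divide_distrib[symmetric] using a b by simp
    finally show ?thesis using a b L_add[OF f g] by (subst X_norm_le_iff) auto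
  qed
  have n: "0 \<le> vnorm X (cl f)" "0 \<le> vnorm X (cl g)" using f g by (simp_all add: X_norm)
  show ?thesis
  proof (rule field_le_epsilon)
    fix e :: real assume "0 < e"
    then show "vnorm X (cl (\<lambda>x. f x + g x)) \<le> vnorm X (cl f) + vnorm X (cl g) + e"
      using le[of "vnorm X (cl f) + e / 2" "vnorm X (cl g) + e / 2"] n by simp
  qed
qed

lemma is_norm_X: "is_norm X (vnorm X)"
  unfolding is_norm_def
proof (intro conjI ballI allI)
  fix F assume "F \<in> vecs X"
  then obtain f where f: "f \<in> vecs L" and F: "F = cl f" by (rule cl_cases)
  show "0 \<le> vnorm X F" using f by (simp add: F X_norm)
  have "vnorm X F = 0 \<longleftrightarrow> (\<integral>x. norm (f x) powr p \<partial>M) = 0" using f by (simp add: F X_norm)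
  also have "\<dots> \<longleftrightarrow> (AE x in M. norm (f x) powr p = 0)"
    using L_integrable[OF f] by (intro integral_nonneg_eq_0_iff_AE) auto
  also have "\<dots> \<longleftrightarrow> F = vzero X"
    using f L.zero_closed unfolding F X_zero by (subst cl_eq_iff) auto
  finally show "vnorm X F = 0 \<longleftrightarrow> F = vzero X" .
next
  fix c F assume "F \<in> vecs X"
  then obtain f where f: "f \<in> vecs L" and F: "F = cl f" by (rule cl_cases)
  have "vnorm X (vscale X c F) = (norm c powr p * (\<integral>x. norm (f x) powr p \<partial>M)) powr (1 / p)"
    using f by (simp add: F X_scale X_norm L_scale norm_mult powr_mult)
  also have "\<dots> = norm c * vnorm X F"
    using p f by (simp add: F X_norm powr_mult powr_powr)
  finally show "vnorm X (vscale X c F) = norm c * vnorm X F" .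
next
  fix F G assume "F \<in> vecs X" "G \<in> vecs X"
  then show "vnorm X (vadd X F G) \<le> vnorm X F + vnorm X G"
    by (elim cl_cases) (simp add: X_add minkowski)
qed

sublocale X: euclidean_normed_structure X
proof -
  interpret Q: vector_structure "quotient_space L null"
    by (rule L.vector_structure_quotient[OF null_subspace])
  show "euclidean_normed_structure X"
  proof unfold_locales
  qed (auto simp: X_quotient Q.add_ac Q.scale_add Q.add_scale intro: is_norm_X)
qed

subsection \<open>Restriction to measurable sets\<close>

definition cut :: "'a set \<Rightarrow> ('a \<Rightarrow> 'k) \<Rightarrow> 'a \<Rightarrow> 'k" where
  "cut D f x = (if x \<in> D then f x else 0)"

definition P :: "'a set \<Rightarrow> ('a \<Rightarrow> 'k) set \<Rightarrow> ('a \<Rightarrow> 'k) set" where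
  "P D F = cl (cut D (SOME f. f \<in> F))"

lemma cut_L [simp]:
  assumes D [measurable]: "D \<in> sets M" and f: "f \<in> vecs L"
  shows "cut D f \<in> vecs L"
proof (rule L_dominated[OF f])
  note [measurable] = LD[OF f]
  show "cut D f \<in> borel_measurable M" unfolding cut_def[abs_def] by measurable
qed (simp add: cut_def)

lemma P_cl:
  assumes D: "D \<in> sets M" and f: "f \<in> vecs L"
  shows "P D (cl f) = cl (cut D f)"
proof -
  have "AE x in M. cut D (SOME g. g \<in> cl f) x = cut D f x"
    using cl_some(2)[OF f] by (rule eventually_mono) (simp add: cut_def)
  then show ?thesis
    unfolding P_def using cl_eq_iff[OF cut_L[OF D cl_some(1)[OF f]] cut_L[OF D f]] by simp
qed

lemma projection_P:
  assumes D: "D \<in> sets M"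
  shows "projection_structure X (P D)"
proof unfold_locales
  fix F assume "F \<in> vecs X"
  then obtain f where f: "f \<in> vecs L" and F: "F = cl f" by (rule cl_cases)
  show "P D F \<in> vecs X" using f D by (simp add: F P_cl)
  have "(\<lambda>x. c * cut D f x) = cut D (\<lambda>x. c * f x)" for c by (auto simp: cut_def)
  then show "P D (vscale X c F) = vscale X c (P D F)" for c
    using f D by (simp add: F P_cl X_scale L_scale)
  have "(\<integral>x. norm (cut D f x) powr p \<partial>M) \<le> (\<integral>x. norm (f x) powr p \<partial>M)"
    by (intro integral_mono L_integrable cut_L D f) (simp add: cut_def)
  then show "vnorm X (P D F) \<le> vnorm X F"
    using f D p by (auto simp: F P_cl X_norm intro!: powr_mono2)
  fix G assume "G \<in> vecs X"
  then obtain g where g: "g \<in> vecs L" and G: "G = cl g" by (rule cl_cases)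
  have "(\<lambda>x. cut D f x + cut D g x) = cut D (\<lambda>x. f x + g x)" by (auto simp: cut_def)
  then show "P D (vadd X F G) = vadd X (P D F) (P D G)"
    using f g D by (simp add: F G P_cl X_add L_add)
qed

text \<open>The copy of L_p(D) inside L_p(mu): the classes vanishing almost everywhere outside
  D.\<close>

abbreviation W :: "'a set \<Rightarrow> ('a \<Rightarrow> 'k) set set" where
  "W D \<equiv> projection_structure.fixed_vecs X (P D)"

lemma W_iff:
  assumes "D \<in> sets M"
  shows "F \<in> W D \<longleftrightarrow> F \<in> vecs X \<and> P D F = F"
proof -
  interpret projection_structure X "P D" using projection_P[OF assms] .
  show ?thesis by (auto simp: fixed_vecs_def)
qed

lemma W_cl_iff:
  assumes "D \<in> sets M" "f \<in> vecs L"
  shows "cl f \<in> W D \<longleftrightarrow> (AE x in M. x \<notin> D \<longrightarrow> f x = 0)"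
proof -
  have "cl f \<in> W D \<longleftrightarrow> (AE x in M. cut D f x = f x)"
    using assms by (simp add: W_iff P_cl cl_eq_iff)
  also have "\<dots> \<longleftrightarrow> (AE x in M. x \<notin> D \<longrightarrow> f x = 0)"
    by (intro AE_cong) (auto simp: cut_def)
  finally show ?thesis .
qed

lemma W_subspace: "D \<in> sets M \<Longrightarrow> vsubspace X (W D)"
  using projection_structure.subspace_fixed_vecs[OF projection_P] .

lemma W_mono:
  assumes "D \<in> sets M" "E \<in> sets M" "D \<subseteq> E"
  shows "W D \<subseteq> W E"
proof
  fix F assume F: "F \<in> W D"
  then have "F \<in> vecs X" using assms by (simp add: W_iff)
  then obtain f where f: "f \<in> vecs L" "F = cl f" by (rule cl_cases)
  then show "F \<in> W E" using F assms by (auto simp: W_cl_iff elim!: eventually_mono)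
qed

text \<open>The witness is the class of the indicator of E. Quantifying over all D' containing E
  lets one vector serve for D and for a tail union at the same time.\<close>

lemma indicator_W:
  assumes D: "D \<in> sets M" and E: "E \<in> sets M" "E \<subseteq> D" "0 < emeasure M E" "emeasure M E < \<infinity>"
  shows "\<exists>F\<in>W D. F \<noteq> vzero X \<and> (\<forall>D'\<in>sets M. E \<subseteq> D' \<longrightarrow> F \<in> W D')"
proof
  let ?f = "indicator E :: 'a \<Rightarrow> 'k"
  have f: "?f \<in> vecs L"
  proof -
    have "(\<lambda>x. norm (?f x) powr p) = (indicator E :: 'a \<Rightarrow> real)" using p by (auto simp: indicator_def)
    then show ?thesis using E by (simp add: L_iff integrable_indicator_iff)
  qed
  have "cl ?f \<in> W D'" if "D' \<in> sets M" "E \<subseteq> D'" for D'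
    using that f by (auto simp: W_cl_iff indicator_def)
  moreover have "cl ?f \<noteq> vzero X"
  proof
    assume "cl ?f = vzero X"
    then have "AE x in M. ?f x = 0" using f L.zero_closed by (simp add: X_zero cl_eq_iff)
    then have "AE x in M. x \<notin> E" by (rule eventually_mono) (auto simp: indicator_def split: if_splits)
    then show False using E by (simp add: AE_iff_null null_sets_def Collect_conj_eq Int_absorb1 sets.sets_into_space)
  qed
  ultimately show "cl ?f \<noteq> vzero X \<and> (\<forall>D'\<in>sets M. E \<subseteq> D' \<longrightarrow> cl ?f \<in> W D')" "cl ?f \<in> W D"
    using E D by blast+
qed

text \<open>Apply \<open>fincodim_tail\<close> to the subspaces of functions supported in the tail
  unions U m. They decrease to zero because the E j are disjoint, and each meets W D nontrivially
  because infinitely many E j lie in D.\<close>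

lemma W_meets_fincodim:
  fixes E :: "nat \<Rightarrow> 'a set"
  assumes E: "\<And>j. E j \<in> sets M" "\<And>j. 0 < emeasure M (E j)" "\<And>j. emeasure M (E j) < \<infinity>"
      "disjoint_family E"
    and D: "D \<in> sets M" and inf: "\<And>m. \<exists>j\<ge>m. E j \<subseteq> D"
    and Y: "closed_fincodim_subspace X Y"
  shows "\<exists>w\<in>W D \<inter> Y. w \<noteq> vzero X"
proof -
  define U where "U m = (\<Union>j\<in>{m..}. E j)" for m :: nat
  have U [measurable, simp]: "U m \<in> sets M" for m unfolding U_def using E by auto
  have "X.fincodim (vecs X \<inter> W D) (Y \<inter> W D)"
    using Y W_subspace[OF D] by (intro X.fincodim_Int) (auto simp: X.closed_fincodim_iff)
  moreover have "vecs X \<inter> W D = W D" using D by (auto simp: W_iff)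
  ultimately have fc: "X.fincodim (W D) (Y \<inter> W D)" by simp
  have "\<exists>w\<in>(Y \<inter> W D) \<inter> W (U 0). w \<noteq> vzero X"
  proof (rule X.fincodim_tail[OF _ _ _ fc])
    show "decseq (\<lambda>m. W (U m))"
      by (rule decseq_SucI, rule W_mono[OF U U]) (auto simp: U_def intro: Suc_leD)
    show "f = vzero X" if fX: "f \<in> vecs X" and fU: "\<And>m. f \<in> W (U m)" for f
    proof -
      obtain g where g: "g \<in> vecs L" "f = cl g" using cl_cases[OF fX] by blast
      have "AE x in M. \<forall>m. x \<notin> U m \<longrightarrow> g x = 0"
        unfolding AE_all_countable using fU g by (auto simp: W_cl_iff)
      \<comment> \<open>A point of E j has left the tails from Suc j on; a point of no E j is in no
        tail.\<close>
      moreover have "\<exists>m. x \<notin> U m" for x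
      proof (cases "\<exists>j. x \<in> E j")
        case True
        then obtain j where "x \<in> E j" ..
        then have "x \<notin> U (Suc j)"
          using E(4) by (auto simp: U_def disjoint_family_on_def) (metis IntI Suc_n_not_le_n empty_iff)
        then show ?thesis ..
      qed (auto simp: U_def)
      ultimately have "AE x in M. g x = 0" by (auto elim!: eventually_mono)
      then show ?thesis using g L.zero_closed by (simp add: X_zero cl_eq_iff)
    qed
    fix m
    show "vsubspace X (W (U m))" by (simp add: W_subspace)
    obtain j where "m \<le> j" "E j \<subseteq> D" using inf by blast
    moreover from \<open>m \<le> j\<close> have "E j \<subseteq> U m" by (auto simp: U_def)
    ultimately show "\<exists>f\<in>W D \<inter> W (U m). f \<noteq> vzero X"
      using indicator_W[OF D E(1) _ E(2,3), of j] U[of m] by blast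
  qed
  then show ?thesis by blast
qed

text \<open>By disjointness at most one summand is nonzero at each point, and it is the integrand of
  F itself.\<close>

lemma sum_restrictions_le:
  assumes I: "finite I" and D: "\<And>i. i \<in> I \<Longrightarrow> D i \<in> sets M" "disjoint_family_on D I"
    and F: "F \<in> vecs X"
  shows "(\<Sum>i\<in>I. vnorm X (P (D i) F) powr p) \<le> vnorm X F powr p"
proof -
  obtain f where f: "f \<in> vecs L" "F = cl f" using F by (rule cl_cases)
  have "(\<Sum>i\<in>I. vnorm X (P (D i) F) powr p) = (\<Sum>i\<in>I. \<integral>x. norm (cut (D i) f x) powr p \<partial>M)"
    using f D by (intro sum.cong) (auto simp: P_cl X_norm_powr)
  also have "\<dots> = (\<integral>x. (\<Sum>i\<in>I. norm (cut (D i) f x) powr p) \<partial>M)"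
    using f D by (subst Bochner_Integration.integral_sum) (auto intro: L_integrable)
  also have "\<dots> \<le> (\<integral>x. norm (f x) powr p \<partial>M)"
  proof (rule integral_mono)
    show "integrable M (\<lambda>x. \<Sum>i\<in>I. norm (cut (D i) f x) powr p)"
      using f D by (intro Bochner_Integration.integrable_sum L_integrable) auto
    show "integrable M (\<lambda>x. norm (f x) powr p)" using f by (simp add: L_integrable)
    fix x
    show "(\<Sum>i\<in>I. norm (cut (D i) f x) powr p) \<le> norm (f x) powr p"
    proof (cases "\<exists>i\<in>I. x \<in> D i")
      case True
      then obtain i where i: "i \<in> I" "x \<in> D i" by blast
      have "(\<Sum>j\<in>I. norm (cut (D j) f x) powr p) = (\<Sum>j\<in>{i}. norm (cut (D j) f x) powr p)"
        using I i D(2) by (intro sum.mono_neutral_right) (auto simp: cut_def disjoint_family_on_def)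
      then show ?thesis by (simp add: cut_def)
    next
      case False
      then have "(\<Sum>j\<in>I. norm (cut (D j) f x) powr p) = 0"
        by (intro sum.neutral) (auto simp: cut_def)
      then show ?thesis by simp
    qed
  qed
  also have "\<dots> = vnorm X F powr p" using f by (simp add: X_norm_powr)
  finally show ?thesis .
qed

section \<open>The covering by slabs\<close>

theorem covering_index_upper:
  fixes E :: "nat \<Rightarrow> 'a set"
  assumes E: "\<And>j. E j \<in> sets M" "\<And>j. 0 < emeasure M (E j)" "\<And>j. emeasure M (E j) < \<infinity>"
      "disjoint_family E"
    and n: "1 \<le> n"
  shows "covering_index X n \<le> ennreal (real n powr (- 1 / p))"
proof -
  define s where "s = real n powr (- 1 / p)"
  \<comment> \<open>Residue classes modulo n divide the sequence into n infinite subsequences; the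
    shift i - 1 matches the indices 1..n with the residues 0..n-1.\<close>
  define D where "D i = (\<Union>j\<in>{j. j mod n = i - 1}. E j)" for i
  have D: "D i \<in> sets M" for i unfolding D_def using E by (intro sets.countable_UN') auto
  have disj: "disjoint_family_on D {1..n}"
    unfolding disjoint_family_on_def
  proof (intro ballI impI)
    fix i k assume "i \<in> {1..n}" "k \<in> {1..n}" "i \<noteq> k"
    then have "i - 1 \<noteq> k - 1" by auto
    then have "E j \<inter> E j' = {}" if "j mod n = i - 1" "j' mod n = k - 1" for j j'
      using that by (intro disjoint_family_onD[OF E(4)]) auto
    then show "D i \<inter> D k = {}" unfolding D_def by blast
  qed
  define A where "A i = projection_structure.slab X (P (D i)) s" for i
  have A_def': "A i = {x \<in> unit_ball X. vnorm X (P (D i) x) \<le> s}" for i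
    unfolding A_def by (rule projection_structure.slab_def[OF projection_P[OF D]])
  have inr: "essential_inradius X (A i) \<le> ennreal s" if i: "i \<in> {1..n}" for i
    unfolding A_def
  proof (rule projection_structure.essential_inradius_slab_le[OF projection_P[OF D]])
    fix Y assume Y: "closed_fincodim_subspace X Y"
    show "\<exists>w\<in>W (D i) \<inter> Y. w \<noteq> vzero X"
    proof (rule W_meets_fincodim[OF E D _ Y])
      fix m
      have "(m * n + (i - 1)) mod n = (i - 1) mod n" by (rule mod_mult_self3)
      also have "\<dots> = i - 1" using i n by (intro mod_less) auto
      finally have "(m * n + (i - 1)) mod n = i - 1" .
      then have "E (m * n + (i - 1)) \<subseteq> D i" unfolding D_def by blast
      moreover have "m \<le> m * n + (i - 1)" using n by (simp add: trans_le_add1)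
      ultimately show "\<exists>j\<ge>m. E j \<subseteq> D i" by blast
    qed
  qed
  have ccb: "A i \<in> closed_convex_bounded X" for i
    unfolding A_def by (rule projection_structure.slab_closed_convex_bounded[OF projection_P[OF D]])
  have cover: "unit_ball X = (\<Union>i\<in>{1..n}. A i)"
  proof
    show "unit_ball X \<subseteq> (\<Union>i\<in>{1..n}. A i)"
    proof (rule subsetI, rule ccontr)
      fix x assume x: "x \<in> unit_ball X" "x \<notin> (\<Union>i\<in>{1..n}. A i)"
      then have xX: "x \<in> vecs X" "vnorm X x \<le> 1" by (auto simp: unit_ball_def)
      \<comment> \<open>A point in no slab has all n restrictions larger than s, whose p-th power is
        1 / n; the p-th powers would then add up to more than 1.\<close>
      have "1 / real n < vnorm X (P (D i) x) powr p" if "i \<in> {1..n}" for i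
      proof -
        have "s powr p = 1 / real n" unfolding s_def powr_powr using p n by (simp add: powr_minus_divide)
        moreover have "s < vnorm X (P (D i) x)" using x that by (force simp: A_def' not_le)
        then have "s powr p < vnorm X (P (D i) x) powr p"
          using p by (intro powr_less_mono2) (auto simp: s_def)
        ultimately show ?thesis by simp
      qed
      then have "(\<Sum>i\<in>{1..n}. 1 / real n) < (\<Sum>i\<in>{1..n}. vnorm X (P (D i) x) powr p)"
        using n by (intro sum_strict_mono) auto
      also have "\<dots> \<le> vnorm X x powr p"
        using D disj xX by (intro sum_restrictions_le) auto
      also have "\<dots> \<le> 1" using xX p by (intro powr_le1) auto
      finally show False using n by simp
    qed
  qed (auto simp: A_def')
  have "covering_index X n \<le> Max ((\<lambda>k. essential_inradius X (A k)) ` {1..n})"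
    unfolding covering_index_def using ccb cover by (intro Inf_lower CollectI exI[of _ A]) auto
  also have "\<dots> \<le> ennreal s" using n inr by (subst Max_le_iff) auto
  finally show ?thesis by (simp add: s_def)
qed

subsection \<open>Infinite dimension yields infinitely many disjoint sets of positive measure\<close>

text \<open>For each U of a countable base, the part of A where f lies in U is null or has null
  complement in A, so membership of f x in U is almost everywhere decided. Outside one null set all
  values on A then belong to the same base sets, and hence coincide.\<close>

lemma AE_const_if_unsplittable:
  fixes f :: "'a \<Rightarrow> 'k"
  assumes f [measurable]: "f \<in> borel_measurable M" and A [measurable]: "A \<in> sets M"
    and uns: "\<And>B. B \<in> sets M \<Longrightarrow> B \<subseteq> A \<Longrightarrow> emeasure M B = 0 \<or> emeasure M (A - B) = 0"
  shows "\<exists>c. AE x in M. x \<in> A \<longrightarrow> f x = c"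
proof (cases "AE x in M. x \<notin> A")
  case True
  then show ?thesis by (auto elim!: eventually_mono)
next
  case False
  obtain \<B> :: "'k set set" where \<B>: "countable \<B>" "topological_basis \<B>"
    using ex_countable_basis by blast
  have "\<exists>b. AE x in M. x \<in> A \<longrightarrow> (f x \<in> U \<longleftrightarrow> b)" if "U \<in> \<B>" for U
  proof -
    have "open U" using \<B>(2) that by (rule topological_basis_open)
    then have [measurable]: "U \<in> sets borel" by simp
    let ?B = "{x\<in>space M. x \<in> A \<and> f x \<in> U}"
    have B: "?B \<in> sets M" by measurable
    then consider "emeasure M ?B = 0" | "emeasure M (A - ?B) = 0" using uns[of ?B] by blast
    then show ?thesis
    proof cases
      case 1
      then have "AE x in M. x \<notin> ?B" using B by (intro AE_not_in) (auto simp: null_sets_def)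
      then have "AE x in M. x \<in> A \<longrightarrow> (f x \<in> U \<longleftrightarrow> False)"
        by (rule eventually_mono[OF eventually_conj[OF _ AE_space]]) auto
      then show ?thesis by blast
    next
      case 2
      then have "AE x in M. x \<notin> A - ?B" using B A by (intro AE_not_in) (auto simp: null_sets_def)
      then have "AE x in M. x \<in> A \<longrightarrow> (f x \<in> U \<longleftrightarrow> True)"
        by (rule eventually_mono[OF eventually_conj[OF _ AE_space]]) auto
      then show ?thesis by blast
    qed
  qed
  then obtain b where b: "\<And>U. U \<in> \<B> \<Longrightarrow> AE x in M. x \<in> A \<longrightarrow> (f x \<in> U \<longleftrightarrow> b U)" by metis
  have ae: "AE x in M. \<forall>U\<in>\<B>. x \<in> A \<longrightarrow> (f x \<in> U \<longleftrightarrow> b U)"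
    by (subst AE_ball_countable[OF \<B>(1)]) (use b in blast)
  \<comment> \<open>A reference point exists because A is not negligible in this case.\<close>
  have "\<exists>x0. x0 \<in> A \<and> (\<forall>U\<in>\<B>. x0 \<in> A \<longrightarrow> (f x0 \<in> U \<longleftrightarrow> b U))"
  proof (rule ccontr)
    assume "\<nexists>x0. x0 \<in> A \<and> (\<forall>U\<in>\<B>. x0 \<in> A \<longrightarrow> (f x0 \<in> U \<longleftrightarrow> b U))"
    then have "AE x in M. x \<notin> A" using ae by (auto elim!: eventually_mono)
    then show False using False by simp
  qed
  then obtain x0 where x0: "x0 \<in> A" "\<And>U. U \<in> \<B> \<Longrightarrow> f x0 \<in> U \<longleftrightarrow> b U" by blast
  have "f x = f x0" if x: "x \<in> A" "\<forall>U\<in>\<B>. x \<in> A \<longrightarrow> (f x \<in> U \<longleftrightarrow> b U)" for x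
  proof (rule ccontr)
    assume "f x \<noteq> f x0"
    then obtain V where V: "open V" "f x \<in> V" "f x0 \<notin> V" using t1_space by blast
    then obtain U where "U \<in> \<B>" "f x \<in> U" "U \<subseteq> V" using topological_basisE[OF \<B>(2)] by metis
    then show False using x x0 V by blast
  qed
  then have "AE x in M. x \<in> A \<longrightarrow> f x = f x0" using ae by (auto elim!: eventually_mono)
  then show ?thesis ..
qed

text \<open>Every function supported in A is almost everywhere constant there, so W A is zero or is
  spanned by any one of its nonzero vectors.\<close>

lemma finitely_spanned_if_unsplittable:
  assumes A: "A \<in> sets M"
    and uns: "\<And>B. B \<in> sets M \<Longrightarrow> B \<subseteq> A \<Longrightarrow> emeasure M B = 0 \<or> emeasure M (A - B) = 0"
  shows "X.finitely_spanned (W A)"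
proof (cases "W A \<subseteq> {vzero X}")
  case True
  moreover have "vzero X \<in> vspan X {}" by (auto simp: vspan_def vsubspace_def)
  ultimately show ?thesis unfolding X.finitely_spanned_def by (intro exI[of _ "{}"]) auto
next
  case False
  then obtain G where G: "G \<in> W A" "G \<noteq> vzero X" by auto
  then obtain g where g: "g \<in> vecs L" "G = cl g" using A by (auto simp: W_iff elim: cl_cases)
  have gA: "AE x in M. x \<notin> A \<longrightarrow> g x = 0" using G g A by (simp add: W_cl_iff)
  obtain c where c: "AE x in M. x \<in> A \<longrightarrow> g x = c"
    using AE_const_if_unsplittable[OF LD[OF g(1)] A uns] by blast
  have "c \<noteq> 0"
  proof
    assume "c = 0"
    show False when "AE x in M. g x = 0"
      using that G(2) g L.zero_closed by (simp add: X_zero cl_eq_iff)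
    show "AE x in M. g x = 0" by (rule eventually_mono[OF eventually_conj[OF gA c]]) (use \<open>c = 0\<close> in auto)
  qed
  have "F \<in> vspan X {G}" if F: "F \<in> W A" for F
  proof -
    obtain f where f: "f \<in> vecs L" "F = cl f" using F A by (auto simp: W_iff elim: cl_cases)
    have fA: "AE x in M. x \<notin> A \<longrightarrow> f x = 0" using F f A by (simp add: W_cl_iff)
    obtain d where d: "AE x in M. x \<in> A \<longrightarrow> f x = d"
      using AE_const_if_unsplittable[OF LD[OF f(1)] A uns] by blast
    have "AE x in M. f x = d / c * g x"
      by (rule eventually_mono[OF eventually_conj[OF eventually_conj[OF gA c] eventually_conj[OF fA d]]])
        (use \<open>c \<noteq> 0\<close> in auto)
    then have "F = vscale X (d / c) G"
      unfolding f(2) g(2) X_scale[OF g(1)] using cl_eq_iff[OF f(1) L_scale[OF g(1)]] by blast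
    then show ?thesis by (auto simp: vspan_def vsubspace_def)
  qed
  then show ?thesis
    unfolding X.finitely_spanned_def using G A by (intro exI[of _ "{G}"]) (auto simp: W_iff)
qed

text \<open>A function supported in A is the sum of its restrictions to B and to A - B.\<close>

lemma finitely_spanned_Un:
  assumes A: "A \<in> sets M" and B: "B \<in> sets M" "B \<subseteq> A" and spanned: "X.finitely_spanned (W B)" "X.finitely_spanned (W (A - B))"
  shows "X.finitely_spanned (W A)"
proof -
  obtain S1 S2 where S: "finite S1" "S1 \<subseteq> vecs X" "W B \<subseteq> vspan X S1"
    "finite S2" "S2 \<subseteq> vecs X" "W (A - B) \<subseteq> vspan X S2"
    using spanned unfolding X.finitely_spanned_def by blast
  have "W A \<subseteq> vspan X (S1 \<union> S2)"
  proof
    fix F assume F: "F \<in> W A"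
    then obtain f where f: "f \<in> vecs L" "F = cl f" using A by (auto simp: W_iff elim: cl_cases)
    have "AE x in M. x \<notin> A \<longrightarrow> f x = 0" using F f A by (simp add: W_cl_iff)
    then have "AE x in M. f x = cut B f x + cut (A - B) f x"
      by (rule eventually_mono) (use B in \<open>auto simp: cut_def\<close>)
    then have "F = vadd X (cl (cut B f)) (cl (cut (A - B) f))"
      using f A B by (simp add: X_add cl_eq_iff L_add)
    moreover have "cl (cut B f) \<in> W B" "cl (cut (A - B) f) \<in> W (A - B)"
      using f A B by (auto simp: W_cl_iff cut_def)
    then have "cl (cut B f) \<in> vspan X (S1 \<union> S2)" "cl (cut (A - B) f) \<in> vspan X (S1 \<union> S2)"
      using S X.span_mono[of S1 "S1 \<union> S2"] X.span_mono[of S2 "S1 \<union> S2"] by auto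
    ultimately show "F \<in> vspan X (S1 \<union> S2)"
      using X.subspaceD(3)[OF X.subspace_span] S by simp
  qed
  then show ?thesis using S unfolding X.finitely_spanned_def by (intro exI[of _ "S1 \<union> S2"]) auto
qed

lemma not_finitely_spanned_space:
  assumes "\<not> finite_dim X"
  shows "\<not> X.finitely_spanned (W (space M))"
proof
  assume "X.finitely_spanned (W (space M))"
  moreover have "W (space M) = vecs X"
  proof (intro set_eqI iffI)
    fix F assume "F \<in> vecs X"
    then obtain f where "f \<in> vecs L" "F = cl f" by (rule cl_cases)
    then show "F \<in> W (space M)" by (auto simp: W_cl_iff)
  qed (simp add: W_iff)
  ultimately show False using assms X.finite_dim_if_finitely_spanned by simp
qed

text \<open>A set A with W A not finitely spanned splits into two pieces of positive measure, and
  one of them again carries a space that is not finitely spanned. That piece is kept and split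
  further. The discarded pieces are disjoint, and sigma-finiteness cuts them down to finite
  measure.\<close>

lemma disjoint_sets_if_infinite_dim:
  assumes inf: "\<not> finite_dim X" and M: "sigma_finite_measure M"
  obtains E :: "nat \<Rightarrow> 'a set" where "\<And>j. E j \<in> sets M" "\<And>j. 0 < emeasure M (E j)"
    "\<And>j. emeasure M (E j) < \<infinity>" "disjoint_family E"
proof -
  have "\<exists>A. \<forall>j. (A j \<in> sets M \<and> \<not> X.finitely_spanned (W (A j))) \<and> (A (Suc j) \<subseteq> A j \<and> 0 < emeasure M (A j - A (Suc j)))"
  proof (rule dependent_nat_choice)
    show "\<exists>A. A \<in> sets M \<and> \<not> X.finitely_spanned (W A)" using not_finitely_spanned_space[OF inf] by blast
    fix A and j :: nat assume A: "A \<in> sets M \<and> \<not> X.finitely_spanned (W A)"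
    then obtain B where B: "B \<in> sets M" "B \<subseteq> A" "0 < emeasure M B" "0 < emeasure M (A - B)"
      using finitely_spanned_if_unsplittable[of A] by (auto simp: zero_less_iff_neq_zero)
    \<comment> \<open>Covers the choice of A - B as the piece kept: the discarded piece is then B,
      which also has positive measure.\<close>
    have "A - (A - B) = B" using B by auto
    moreover have "\<not> X.finitely_spanned (W B) \<or> \<not> X.finitely_spanned (W (A - B))" using finitely_spanned_Un A B by blast
    ultimately show "\<exists>B. (B \<in> sets M \<and> \<not> X.finitely_spanned (W B)) \<and> B \<subseteq> A \<and> 0 < emeasure M (A - B)"
      using A B by (metis Diff_subset sets.Diff)
  qed
  then obtain A where A: "\<And>j. A j \<in> sets M" "\<And>j. A (Suc j) \<subseteq> A j"
    "\<And>j. 0 < emeasure M (A j - A (Suc j))" by blast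
  have dec: "decseq A" using A(2) by (rule decseq_SucI)
  obtain S :: "nat \<Rightarrow> 'a set" where S: "range S \<subseteq> sets M" "(\<Union>i. S i) = space M"
    "\<And>i. emeasure M (S i) \<noteq> \<infinity>"
    using sigma_finite_measure.sigma_finite[OF M] by metis
  \<comment> \<open>If all intersections with the countably many S i were null, so would be the
    whole difference, which they cover.\<close>
  have "\<exists>i. 0 < emeasure M ((A j - A (Suc j)) \<inter> S i)" for j
  proof (rule ccontr)
    assume "\<nexists>i. 0 < emeasure M ((A j - A (Suc j)) \<inter> S i)"
    then have "(A j - A (Suc j)) \<inter> S i \<in> null_sets M" for i
      using A S by (auto simp: null_sets_def zero_less_iff_neq_zero)
    then have "(\<Union>i. (A j - A (Suc j)) \<inter> S i) \<in> null_sets M" by (intro null_sets_UN) auto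
    moreover have "(\<Union>i. (A j - A (Suc j)) \<inter> S i) = A j - A (Suc j)"
      using S(2) sets.sets_into_space[OF A(1)[of j]] by auto
    ultimately show False using A(3)[of j] by (simp add: null_sets_def)
  qed
  then obtain k where k: "\<And>j. 0 < emeasure M ((A j - A (Suc j)) \<inter> S (k j))" by metis
  show thesis
  proof (rule that[of "\<lambda>j. (A j - A (Suc j)) \<inter> S (k j)"])
    fix j
    show "(A j - A (Suc j)) \<inter> S (k j) \<in> sets M" using A S by auto
    show "0 < emeasure M ((A j - A (Suc j)) \<inter> S (k j))" by (rule k)
    have "emeasure M ((A j - A (Suc j)) \<inter> S (k j)) \<le> emeasure M (S (k j))"
      using S by (intro emeasure_mono) auto
    also have "\<dots> < \<infinity>" using S(3) by (simp add: top.not_eq_extremum)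
    finally show "emeasure M ((A j - A (Suc j)) \<inter> S (k j)) < \<infinity>" .
  next
    have "(A i - A (Suc i)) \<inter> (A j - A (Suc j)) = {}" if "i < j" for i j
      using decseqD[OF dec, of "Suc i" j] that by auto
    then have "(A i - A (Suc i)) \<inter> (A j - A (Suc j)) = {}" if "i \<noteq> j" for i j
      using that by (cases i j rule: linorder_cases) (auto simp: Int_commute)
    then show "disjoint_family (\<lambda>j. (A j - A (Suc j)) \<inter> S (k j))"
      unfolding disjoint_family_on_def by blast
  qed
qed

theorem covering_index_asymp:
  assumes M: "sigma_finite_measure M" and inf: "\<not> finite_dim X" and AUS: "AUS_renormable p X"
  shows "(\<exists>c>0. \<forall>n\<ge>1. ennreal (c * real n powr (- 1 / p)) \<le> covering_index X n) \<and>
    (\<exists>c>0. \<exists>C>0. \<forall>n\<ge>1. ennreal (c * real n powr (- 1 / p)) \<le> covering_index X n \<and>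
       covering_index X n \<le> ennreal (C * real n powr (- 1 / p)))"
proof -
  obtain c where c: "0 < c" "\<forall>n\<ge>1. ennreal (c * real n powr (- 1 / p)) \<le> covering_index X n"
    using X.covering_index_lower[OF p inf AUS] by blast
  obtain E :: "nat \<Rightarrow> 'a set" where E: "\<And>j. E j \<in> sets M" "\<And>j. 0 < emeasure M (E j)"
    "\<And>j. emeasure M (E j) < \<infinity>" "disjoint_family E"
    using disjoint_sets_if_infinite_dim[OF inf M] by blast
  have "\<forall>n\<ge>1. covering_index X n \<le> ennreal (1 * real n powr (- 1 / p))"
    using covering_index_upper[OF E] by simp
  then show ?thesis using c zero_less_one by blast
qed

end

theorem corollary3p3:
  fixes M :: "'a measure" and p :: real
  assumes "1 < p" and "sigma_finite_measure M"
  shows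
    "(let X = (Lp_space M p :: (real, ('a \<Rightarrow> real) set) nspace) in
        \<not> finite_dim X \<and> AUS_renormable p X \<longrightarrow>
          (\<exists>c>0. \<forall>n\<ge>1. covering_index X n \<ge> ennreal (c * real n powr (- 1 / p))) \<and>
          (\<exists>c>0. \<exists>C>0. \<forall>n\<ge>1. ennreal (c * real n powr (- 1 / p)) \<le> covering_index X n \<and>
             covering_index X n \<le> ennreal (C * real n powr (- 1 / p)))) \<and>
     (let X = (Lp_space M p :: (complex, ('a \<Rightarrow> complex) set) nspace) in
        \<not> finite_dim X \<and> AUS_renormable p X \<longrightarrow>
          (\<exists>c>0. \<forall>n\<ge>1. covering_index X n \<ge> ennreal (c * real n powr (- 1 / p))) \<and>
          (\<exists>c>0. \<exists>C>0. \<forall>n\<ge>1. ennreal (c * real n powr (- 1 / p)) \<le> covering_index X n \<and>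
             covering_index X n \<le> ennreal (C * real n powr (- 1 / p))))"
proof -
  interpret R: Lp_structure M p "TYPE(real)" using assms(1) by unfold_locales
  interpret C: Lp_structure M p "TYPE(complex)" using assms(1) by unfold_locales
  show ?thesis
    using R.covering_index_asymp[OF assms(2)] C.covering_index_asymp[OF assms(2)]
    unfolding Let_def by blast
qed

end
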